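(* For any nonlocal game $\mathcal G=\mathcal G(\pi,V)$ we have $\omega_{\mathcal Q}(\mathcal G)\le\omega(\mathcal{DNN},\mathcal G)\le \mathrm{SDP}^{(1)}(\mathcal G)$.
   Context: A nonlocal game $\mathcal G(\pi,V)$ consists of finite nonempty sets $S,T$ (questions), $A,B$ (answers), a probability distribution $\pi$ on $S\times T$ and a predicate $V:A\times B\times S\times T\to\{0,1\}$, written $V(a,b|s,t)$. For $p=(p(a,b|s,t))$ put $\mathrm{win}(p):=\sum_{s,t}\pi(s,t)\sum_{a,b}V(a,b|s,t)p(a,b|s,t)$. $\mathcal{P}$ is the set of vectors $p=(p(a,b|s,t))$ with $p(a,b|s,t)\ge 0$ and $\sum_{a,b}p(a,b|s,t)=1$ for all $s,t$. $\mathcal{Q}$ is the set of $p\in\mathcal P$ such that there are finite-dimensional complex Euclidean spaces $\mathcal X,\mathcal Y$, a unit vector $\psi\in\mathcal X\otimes\mathcal Y$, Hermitian psd operators $X_a^s$ on $\mathcal X$ with $\sum_{a\in A} X_a^s=\mathbb I_{\mathcal X}$ for each $s$, and Hermitian psd operators $Y_b^t$ on $\mathcal Y$ with $\sum_{b\in B} Y_b^t=\mathbb I_{\mathcal Y}$ for each $t$, with $p(a,b|s,t)=\psi^*(X_a^s\otimes Y_b^t)\psi$ for all $a,b,s,t$. $\mathcal{NS}$ is the set of $p\in\mathcal P$ with $\sum_b p(a,b|s,t)=\sum_b p(a,b|s,t')$ for all $a,s,t\neq t'$ and $\sum_a p(a,b|s,t)=\sum_a p(a,b|s',t)$ for all $b,t,s\ne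 s'$. For $p\in\mathcal{NS}$ let $p_A(a|s):=\sum_b p(a,b|s,t)$, $p_B(b|t):=\sum_a p(a,b|s,t)$ (well defined), and $p_A\in\mathbb R^{|S\times A|}$, $p_B\in\mathbb R^{|T\times B|}$ the corresponding vectors. The quantum value is $\omega_{\mathcal Q}(\mathcal G):=\sup\{\mathrm{win}(p):p\in\mathcal Q\}$. Let $N=|S||A|+|T||B|$; real symmetric $N\times N$ matrices are indexed by the disjoint union of $S\times A$ and $T\times B$ (in $S\cup T$, $S$ and $T$ are regarded as disjoint). $\mathcal S_+^n$ is the set of real symmetric psd $n\times n$ matrices and $\mathcal{DNN}^n$ the subset with all entries nonnegative. $\langle J_{i,j},X\rangle:=\sum_{k,l}X[(i,k),(j,l)]$ is the sum of entries of the $(i,j)$ block, $i,j\in S\cup T$. Let $C[(s,a),(t,b)]=\pi(s,t)V(a,b|s,t)$ and $\hat C=\frac12\begin{pmatrix}0&C\\C^{\mathsf T}&0\end{pmatrix}$. Then $$\omega(\mathcal{DNN},\mathcal G):=\sup\{\mathrm{Tr}(\hat CX):\langle J_{i,j},X\rangle=1\ \forall i,j\in S\cup T,\ X\in\mathcal{DNN}^N\}.$$ $\mathrm{NPA}^{(1)}$ is the set of $p\in\mathcal{NS}$ for which, with $P[(s,a),(t,b)]=p(a,b|s,t)$, there exist symmetric $X,Y$ such that $\begin{pmatrix}1&p_A^{\mathsf T}&p_B^{\mathsf T}\\ p_A&X&P\\ p_B&P^{\mathsf T}&Y\end{pmatrix}\in\mathcal S_+^{1+N}$, $X[(s,a),(s,a')]=\delta_{a,a'}p_A(a|s)$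 for all $s,a,a'$, and $Y[(t,b),(t,b')]=\delta_{b,b'}p_B(b|t)$ for all $t,b,b'$. Finally $\mathrm{SDP}^{(1)}(\mathcal G):=\sup\{\mathrm{win}(p):p\in\mathrm{NPA}^{(1)}\}$. *)

theory Defs
  imports
    "HOL-Probability.Probability_Mass_Function"
    "HOL-Analysis.Analysis"
    "Jordan_Normal_Form.Schur_Decomposition"
begin

text \<open>
  The question sets \<open>S\<close>, \<open>T\<close> and the answer sets \<open>A\<close>, \<open>B\<close> are finite types.  Real matrices, which
  are indexed by finite sets built from these, are those of \<open>HOL-Analysis\<close> (entries \<open>X $ i $ j\<close>).
  Operators on the quantum spaces, whose dimension is existentially quantified, are those of
  \<open>Jordan_Normal_Form\<close> (entries \<open>A $$ (i, j)\<close>); of the two competing meanings of \<open>$\<close> only the first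
  is kept.
\<close>

no_notation vec_index (infixl "$" 100)

subsection \<open>Games and correlations\<close>

type_synonym ('a, 'b, 's, 't) predicate = "'a \<Rightarrow> 'b \<Rightarrow> 's \<Rightarrow> 't \<Rightarrow> bool"
type_synonym ('a, 'b, 's, 't) correlation = "'a \<Rightarrow> 'b \<Rightarrow> 's \<Rightarrow> 't \<Rightarrow> real"

definition win ::
  "('s::finite \<times> 't::finite) pmf \<Rightarrow> ('a::finite, 'b::finite, 's, 't) predicate
     \<Rightarrow> ('a, 'b, 's, 't) correlation \<Rightarrow> real" where
  "win \<pi> V p = (\<Sum>s\<in>UNIV. \<Sum>t\<in>UNIV. pmf \<pi> (s, t) *
                 (\<Sum>a\<in>UNIV. \<Sum>b\<in>UNIV. of_bool (V a b s t) * p a b s t))"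

definition correlations :: "('a::finite, 'b::finite, 's, 't) correlation set" where
  "correlations = {p. (\<forall>a b s t. 0 \<le> p a b s t) \<and> (\<forall>s t. (\<Sum>a\<in>UNIV. \<Sum>b\<in>UNIV. p a b s t) = 1)}"

definition no_signalling :: "('a::finite, 'b::finite, 's, 't) correlation set" where
  "no_signalling = {p \<in> correlations.
     (\<forall>a s t t'. (\<Sum>b\<in>UNIV. p a b s t) = (\<Sum>b\<in>UNIV. p a b s t')) \<and>
     (\<forall>b t s s'. (\<Sum>a\<in>UNIV. p a b s t) = (\<Sum>a\<in>UNIV. p a b s' t))}"

text \<open>The marginals are only meaningful for no-signalling \<open>p\<close>, where the described value exists.\<close>

definition marginal_A :: "('a::finite, 'b::finite, 's, 't) correlation \<Rightarrow> 'a \<Rightarrow> 's \<Rightarrow> real" where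
  "marginal_A p a s = (THE x. \<forall>t. x = (\<Sum>b\<in>UNIV. p a b s t))"

definition marginal_B :: "('a::finite, 'b::finite, 's, 't) correlation \<Rightarrow> 'b \<Rightarrow> 't \<Rightarrow> real" where
  "marginal_B p b t = (THE x. \<forall>s. x = (\<Sum>a\<in>UNIV. p a b s t))"

subsection \<open>Quantum correlations\<close>

definition hermitian_psd :: "nat \<Rightarrow> complex mat \<Rightarrow> bool" where
  "hermitian_psd n M \<longleftrightarrow> M \<in> carrier_mat n n \<and> mat_adjoint M = M \<and>
     (\<forall>v \<in> carrier_vec n. 0 \<le> (M *\<^sub>v v) \<bullet>c v)"

text \<open>
  The Kronecker product represents the tensor product of operators; the product basis vector
  \<open>e\<^sub>i \<otimes> e\<^sub>j\<close> of \<open>\<complex>\<^sup>n \<otimes> \<complex>\<^sup>m\<close> is the basis vector number \<open>i * m + j\<close> of \<open>\<complex>\<^sup>n\<^sup>m\<close>.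
\<close>

definition kronecker :: "complex mat \<Rightarrow> complex mat \<Rightarrow> complex mat" where
  "kronecker M N = mat (dim_row M * dim_row N) (dim_col M * dim_col N)
     (\<lambda>(i, j). M $$ (i div dim_row N, j div dim_col N) * N $$ (i mod dim_row N, j mod dim_col N))"

text \<open>A POVM on \<open>\<complex>\<^sup>n\<close>; \<open>Jordan_Normal_Form\<close> matrices have no type-class sum, hence the entrywise one.\<close>

definition povm :: "nat \<Rightarrow> ('a::finite \<Rightarrow> complex mat) \<Rightarrow> bool" where
  "povm n M \<longleftrightarrow> (\<forall>a. hermitian_psd n (M a)) \<and>
     mat n n (\<lambda>ij. \<Sum>a\<in>UNIV. M a $$ ij) = 1\<^sub>m n"

definition quantum_correlations :: "('a::finite, 'b::finite, 's, 't) correlation set" where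
  "quantum_correlations = {p \<in> correlations.
     \<exists>n m \<psi> X Y.
       \<psi> \<in> carrier_vec (n * m) \<and> \<psi> \<bullet>c \<psi> = 1 \<and>
       (\<forall>s. povm n (X s)) \<and> (\<forall>t. povm m (Y t)) \<and>
       (\<forall>a b s t. complex_of_real (p a b s t) = (kronecker (X s a) (Y t b) *\<^sub>v \<psi>) \<bullet>c \<psi>)}"

text \<open>
  The feasible sets of the three optimisation problems below are nonempty and their objectives
  bounded, so that \<open>Sup\<close> on the reals is the actual supremum.
\<close>

definition quantum_value ::
  "('s::finite \<times> 't::finite) pmf \<Rightarrow> ('a::finite, 'b::finite, 's, 't) predicate \<Rightarrow> real" where
  "quantum_value \<pi> V = Sup (win \<pi> V ` quantum_correlations)"

subsection \<open>The doubly nonnegative relaxation\<close>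

definition psd_matrices :: "(real ^ 'n ^ 'n) set" where
  "psd_matrices = {X. transpose X = X \<and> (\<forall>v. 0 \<le> inner v (X *v v))}"

definition dnn_matrices :: "(real ^ 'n ^ 'n) set" where
  "dnn_matrices = {X \<in> psd_matrices. \<forall>i j. 0 \<le> X $ i $ j}"

type_synonym ('a, 'b, 's, 't) index = "('s \<times> 'a) + ('t \<times> 'b)"

text \<open>The indices \<open>(i, k)\<close> belonging to the question \<open>i \<in> S \<union> T\<close>.\<close>

fun block :: "'s + 't \<Rightarrow> ('a, 'b, 's, 't) index set" where
  "block (Inl s) = {Inl (s, a) | a. True}"
| "block (Inr t) = {Inr (t, b) | b. True}"

definition block_sum ::
  "'s + 't \<Rightarrow> 's + 't
     \<Rightarrow> real ^ ('a::finite, 'b::finite, 's::finite, 't::finite) index ^ ('a, 'b, 's, 't) index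
     \<Rightarrow> real" where
  "block_sum i j X = (\<Sum>x\<in>block i. \<Sum>y\<in>block j. X $ x $ y)"

definition cost_matrix ::
  "('s::finite \<times> 't::finite) pmf \<Rightarrow> ('a::finite, 'b::finite, 's, 't) predicate
     \<Rightarrow> real ^ ('t \<times> 'b) ^ ('s \<times> 'a)" where
  "cost_matrix \<pi> V = (\<chi> x y. case (x, y) of ((s, a), (t, b)) \<Rightarrow> pmf \<pi> (s, t) * of_bool (V a b s t))"

definition symm_cost_matrix ::
  "('s::finite \<times> 't::finite) pmf \<Rightarrow> ('a::finite, 'b::finite, 's, 't) predicate
     \<Rightarrow> real ^ ('a, 'b, 's, 't) index ^ ('a, 'b, 's, 't) index" where
  "symm_cost_matrix \<pi> V = (1 / 2) *\<^sub>R (\<chi> i j. case (i, j) of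
       (Inl x, Inr y) \<Rightarrow> cost_matrix \<pi> V $ x $ y
     | (Inr y, Inl x) \<Rightarrow> transpose (cost_matrix \<pi> V) $ y $ x
     | _ \<Rightarrow> 0)"

definition dnn_value ::
  "('s::finite \<times> 't::finite) pmf \<Rightarrow> ('a::finite, 'b::finite, 's, 't) predicate \<Rightarrow> real" where
  "dnn_value \<pi> V = Sup {trace (symm_cost_matrix \<pi> V ** X) | X.
     (\<forall>i j. block_sum i j X = 1) \<and> X \<in> dnn_matrices}"

subsection \<open>The first level of the NPA hierarchy\<close>

text \<open>The block matrix with rows \<open>(1, p\<^sub>A, p\<^sub>B)\<close>, \<open>(p\<^sub>A, X, P)\<close>, \<open>(p\<^sub>B, P\<^sup>T, Y)\<close>; the extra index is \<open>Inl ()\<close>.\<close>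

definition npa_matrix ::
  "('a::finite, 'b::finite, 's::finite, 't::finite) correlation
     \<Rightarrow> real ^ ('s \<times> 'a) ^ ('s \<times> 'a) \<Rightarrow> real ^ ('t \<times> 'b) ^ ('t \<times> 'b)
     \<Rightarrow> real ^ (unit + ('a, 'b, 's, 't) index) ^ (unit + ('a, 'b, 's, 't) index)" where
  "npa_matrix p X Y = (\<chi> i j. case (i, j) of
       (Inl _, Inl _) \<Rightarrow> 1
     | (Inl _, Inr (Inl (s, a))) \<Rightarrow> marginal_A p a s
     | (Inl _, Inr (Inr (t, b))) \<Rightarrow> marginal_B p b t
     | (Inr (Inl (s, a)), Inl _) \<Rightarrow> marginal_A p a s
     | (Inr (Inr (t, b)), Inl _) \<Rightarrow> marginal_B p b t
     | (Inr (Inl x), Inr (Inl x')) \<Rightarrow> X $ x $ x'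
     | (Inr (Inr y), Inr (Inr y')) \<Rightarrow> Y $ y $ y'
     | (Inr (Inl (s, a)), Inr (Inr (t, b))) \<Rightarrow> p a b s t
     | (Inr (Inr (t, b)), Inr (Inl (s, a))) \<Rightarrow> p a b s t)"

definition npa1 :: "('a::finite, 'b::finite, 's::finite, 't::finite) correlation set" where
  "npa1 = {p \<in> no_signalling. \<exists>X Y.
     transpose X = X \<and> transpose Y = Y \<and> npa_matrix p X Y \<in> psd_matrices \<and>
     (\<forall>s a a'. X $ (s, a) $ (s, a') = (if a = a' then marginal_A p a s else 0)) \<and>
     (\<forall>t b b'. Y $ (t, b) $ (t, b') = (if b = b' then marginal_B p b t else 0))}"

definition sdp1_value ::
  "('s::finite \<times> 't::finite) pmf \<Rightarrow> ('a::finite, 'b::finite, 's, 't) predicate \<Rightarrow> real" where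
  "sdp1_value \<pi> V = Sup (win \<pi> V ` npa1)"

end

theory Submission
  imports Defs
begin

text \<open>
  First inequality: write the state as \<open>\<psi> = \<Sum>\<^sub>k d\<^sub>k u\<^sub>k \<otimes> v\<^sub>k\<close> (Schmidt decomposition) and compress the
  measurement operators to the Schmidt bases. With \<open>D = diag(d)\<close>, the operators \<open>D\<^sup>\<onehalf> E D\<^sup>\<onehalf>\<close> of both
  players (those of the second one transposed) are psd, each player's operators sum to \<open>D\<close>, and their
  Hilbert-Schmidt Gram matrix is doubly nonnegative with all block sums \<open>Tr(D\<^sup>2) = 1\<close> and with the
  correlation as off-diagonal part.

  Second inequality: let \<open>X\<close> be feasible for the doubly nonnegative program. The block indicators all have
  the same image \<open>g\<close> under \<open>X\<close>, which says that the off-diagonal part of \<open>X\<close> is a no-signalling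
  correlation with marginals \<open>g\<close>, and bordering \<open>X\<close> with \<open>g\<close> and \<open>1\<close> keeps it psd. Replacing the diagonal
  blocks by \<open>diag(g)\<close> adds a graph Laplacian and yields a certificate for the first level of NPA.
\<close>

subsection \<open>Schmidt decomposition\<close>

text \<open>By Tychonoff. Forcing the value 0 outside \<open>I\<close> puts the set inside a product
  of unit discs and points, from which the norm condition cuts out a closed subset.\<close>

lemma compact_unit_sphere_fun:
  fixes I :: "'i set"
  assumes "finite I"
  shows "compact {f :: 'i \<Rightarrow> complex. (\<forall>i. i \<notin> I \<longrightarrow> f i = 0) \<and> (\<Sum>i\<in>I. (cmod (f i))\<^sup>2) = 1}"
    (is "compact ?C")
proof -
  define B where "B = (\<lambda>i. if i \<in> I then cball (0 :: complex) 1 else {0})"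
  have "compactin (product_topology (\<lambda>i::'i. euclidean :: complex topology) UNIV) (PiE UNIV B)"
    by (auto simp: compactin_PiE B_def)
  then have "compact (PiE UNIV B)"
    by (simp add: euclidean_product_topology)
  moreover have "?C = PiE UNIV B \<inter> {f. (\<Sum>i\<in>I. (cmod (f i))\<^sup>2) = 1}"
  proof -
    have "cmod (f i) \<le> 1" if "i \<in> I" "(\<Sum>i\<in>I. (cmod (f i))\<^sup>2) = 1" for f :: "'i \<Rightarrow> complex" and i
    proof -
      have "(cmod (f i))\<^sup>2 \<le> (\<Sum>i\<in>I. (cmod (f i))\<^sup>2)"
        using assms that(1) by (intro member_le_sum) auto
      then show ?thesis
        using that(2) by (simp add: abs_square_le_1)
    qed
    then show ?thesis
      by (auto simp: B_def PiE_def Pi_def split: if_splits)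
  qed
  moreover have "closed {f :: 'i \<Rightarrow> complex. (\<Sum>i\<in>I. (cmod (f i))\<^sup>2) = 1}"
    by (intro closed_Collect_eq continuous_intros) auto
  ultimately show ?thesis
    by (simp add: compact_Int_closed)
qed

text \<open>Equality case of Cauchy-Schwarz. The normalised conjugate of \<open>w\<close> competes
  with value \<open>N\<close>, the norm of \<open>w\<close>, so \<open>N \<le> d\<close>; the
  squared distance from \<open>w\<close> to \<open>d\<close> times the conjugate of \<open>x\<close>
  is \<open>N^2 - d^2\<close>, hence 0.\<close>

lemma unit_maximizer_eq:
  fixes w x :: "'i \<Rightarrow> complex"
  assumes "finite I"
    and x: "(\<Sum>i\<in>I. (cmod (x i))\<^sup>2) = 1" "Re (\<Sum>i\<in>I. x i * w i) = d"
    and max: "\<And>f. (\<forall>i. i \<notin> I \<longrightarrow> f i = 0) \<Longrightarrow> (\<Sum>i\<in>I. (cmod (f i))\<^sup>2) = 1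
                \<Longrightarrow> Re (\<Sum>i\<in>I. f i * w i) \<le> d"
    and "i \<in> I"
  shows "w i = d * cnj (x i)"
proof (cases "\<forall>i\<in>I. w i = 0")
  case True
  then show ?thesis using x(2) \<open>i \<in> I\<close> by simp
next
  case False
  define N where "N = sqrt (\<Sum>i\<in>I. (cmod (w i))\<^sup>2)"
  have "(\<Sum>i\<in>I. (cmod (w i))\<^sup>2) > 0"
    using False \<open>finite I\<close> by (auto intro: sum_pos2)
  then have N: "N > 0" "N\<^sup>2 = (\<Sum>i\<in>I. (cmod (w i))\<^sup>2)"
    by (auto simp: N_def)
  define f where "f = (\<lambda>i. if i \<in> I then cnj (w i) / N else 0)"
  have "(\<Sum>i\<in>I. (cmod (f i))\<^sup>2) = (\<Sum>i\<in>I. (cmod (w i))\<^sup>2) / N\<^sup>2"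
    using N(1) by (simp add: f_def norm_divide power_divide sum_divide_distrib)
  also have "\<dots> = 1" using N(1) by (simp flip: N(2))
  finally have f1: "(\<Sum>i\<in>I. (cmod (f i))\<^sup>2) = 1" .
  have "(\<Sum>i\<in>I. f i * w i) = (\<Sum>i\<in>I. complex_of_real ((cmod (w i))\<^sup>2) / N)"
    by (intro sum.cong refl) (simp add: f_def mult.commute complex_norm_square del: of_real_power)
  also have "\<dots> = complex_of_real (N\<^sup>2 / N)"
    by (simp only: N(2) of_real_sum of_real_divide sum_divide_distrib)
  also have "\<dots> = N"
    using N(1) by (simp add: power2_eq_square)
  finally have "N \<le> d"
    using max[OF _ f1] by (simp add: f_def)
  have "(\<Sum>i\<in>I. (cmod (w i - d * cnj (x i)))\<^sup>2)
      = (\<Sum>i\<in>I. (cmod (w i))\<^sup>2 - 2 * d * Re (x i * w i) + d\<^sup>2 * (cmod (x i))\<^sup>2)"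
    by (intro sum.cong refl, simp only: cmod_power2) (simp add: power2_eq_square algebra_simps)
  also have "\<dots> = N\<^sup>2 - 2 * d * Re (\<Sum>i\<in>I. x i * w i) + d\<^sup>2 * (\<Sum>i\<in>I. (cmod (x i))\<^sup>2)"
    by (simp only: sum.distrib sum_subtractf N(2) sum_distrib_left Re_sum)
  also have "\<dots> = N\<^sup>2 - d\<^sup>2"
    unfolding x by (simp add: power2_eq_square)
  also have "\<dots> \<le> 0"
    using \<open>N \<le> d\<close> N(1) by (simp add: power_mono)
  finally have "(\<Sum>i\<in>I. (cmod (w i - d * cnj (x i)))\<^sup>2) = 0"
    by (smt (verit) sum_nonneg zero_le_power2)
  then have "(cmod (w i - d * cnj (x i)))\<^sup>2 = 0"
    using \<open>finite I\<close> \<open>i \<in> I\<close> by (subst (asm) sum_nonneg_eq_0_iff) auto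
  then show ?thesis by simp
qed

text \<open>A maximiser of the bilinear form of \<open>K\<close> over pairs of unit vectors is a singular pair.\<close>

lemma exists_singular_pair:
  fixes K :: "'i \<Rightarrow> 'j \<Rightarrow> complex"
  assumes fin: "finite I" "finite J" and nz: "i0 \<in> I" "j0 \<in> J" "K i0 j0 \<noteq> 0"
  obtains x y and d :: real where "d > 0"
    "(\<Sum>i\<in>I. (cmod (x i))\<^sup>2) = 1" "(\<Sum>j\<in>J. (cmod (y j))\<^sup>2) = 1"
    "\<And>i. i \<in> I \<Longrightarrow> (\<Sum>j\<in>J. K i j * y j) = d * cnj (x i)"
    "\<And>j. j \<in> J \<Longrightarrow> (\<Sum>i\<in>I. K i j * x i) = d * cnj (y j)"
proof -
  define C where "C = {f :: 'i \<Rightarrow> complex. (\<forall>i. i \<notin> I \<longrightarrow> f i = 0) \<and> (\<Sum>i\<in>I. (cmod (f i))\<^sup>2) = 1}"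
  define D where "D = {f :: 'j \<Rightarrow> complex. (\<forall>i. i \<notin> J \<longrightarrow> f i = 0) \<and> (\<Sum>i\<in>J. (cmod (f i))\<^sup>2) = 1}"
  define g where "g = (\<lambda>p. Re (\<Sum>i\<in>I. \<Sum>j\<in>J. fst p i * K i j * snd p j))"
  define e where "e = (\<lambda>i. if i = i0 then 1 else 0 :: complex)"
  \<comment> \<open>The phase \<open>c\<close> turns \<open>K i0 j0\<close> into its modulus. The
    pair \<open>(e, h)\<close> therefore has a positive value, which forces the maximum
    \<open>d\<close> to be positive.\<close>
  define c where "c = cnj (K i0 j0) / cmod (K i0 j0)"
  define h where "h = (\<lambda>j. if j = j0 then c else 0)"
  have if_sq: "(cmod (if P then a else 0))\<^sup>2 = (if P then (cmod a)\<^sup>2 else 0)" for P a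
    by simp
  have "e \<in> C" "h \<in> D"
    using nz fin by (auto simp: C_def D_def e_def h_def c_def if_sq norm_divide)
  have if_mult: "(if P then a else 0) * b = (if P then a * b else 0)"
    "b * (if P then a else 0) = (if P then b * a else 0)" for P and a b :: complex
    by auto
  have "g (e, h) = Re (K i0 j0 * c)"
    using nz fin by (simp add: g_def e_def h_def if_mult del: Re_sum times_complex.sel)
  also have "\<dots> = cmod (K i0 j0)"
  proof -
    have "K i0 j0 * c = complex_of_real ((cmod (K i0 j0))\<^sup>2) / cmod (K i0 j0)"
      unfolding complex_norm_square by (simp add: c_def)
    also have "\<dots> = complex_of_real (cmod (K i0 j0))"
      using nz by (simp add: power2_eq_square)
    finally show ?thesis by simp
  qed
  finally have "g (e, h) > 0" using nz by simp
  have "continuous_on (C \<times> D) g"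
    unfolding g_def
    by (intro continuous_intros continuous_on_product_then_coordinatewise)
  then obtain z where z: "z \<in> C \<times> D" "\<And>z'. z' \<in> C \<times> D \<Longrightarrow> g z' \<le> g z"
    using continuous_attains_sup[of "C \<times> D" g] \<open>e \<in> C\<close> \<open>h \<in> D\<close>
      compact_Times[OF compact_unit_sphere_fun[OF fin(1)] compact_unit_sphere_fun[OF fin(2)]]
    unfolding C_def[symmetric] D_def[symmetric] by (metis SigmaI empty_iff)
  obtain x y where xy: "z = (x, y)" by (cases z)
  define d where "d = g (x, y)"
  have C: "x \<in> C" "y \<in> D" and max: "\<And>f k. f \<in> C \<Longrightarrow> k \<in> D \<Longrightarrow> g (f, k) \<le> d"
    using z by (auto simp: xy d_def)
  \<comment> \<open>With one argument fixed, \<open>g\<close> is the real part of a linear form in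
    the other. Each half of the maximiser thus maximises a linear form over a unit sphere, the
    situation of \<open>unit_maximizer_eq\<close>.\<close>
  have g1: "g (f, k) = Re (\<Sum>i\<in>I. f i * (\<Sum>j\<in>J. K i j * k j))" for f k
    by (simp add: g_def sum_distrib_left mult.assoc)
  have g2: "g (f, k) = Re (\<Sum>j\<in>J. k j * (\<Sum>i\<in>I. K i j * f i))" for f k
    by (simp only: g_def fst_conv snd_conv sum_distrib_left, subst sum.swap) (simp add: mult_ac)
  show thesis
  proof (rule that[of d x y])
    show "d > 0" using max[OF \<open>e \<in> C\<close> \<open>h \<in> D\<close>] \<open>g (e, h) > 0\<close> by simp
    show "(\<Sum>i\<in>I. (cmod (x i))\<^sup>2) = 1" "(\<Sum>j\<in>J. (cmod (y j))\<^sup>2) = 1"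
      using C by (auto simp: C_def D_def)
    show "(\<Sum>j\<in>J. K i j * y j) = d * cnj (x i)" if "i \<in> I" for i
      by (rule unit_maximizer_eq[OF fin(1) _ _ _ that])
         (use C max[OF _ C(2)] in \<open>auto simp: C_def d_def g1\<close>)
    show "(\<Sum>i\<in>I. K i j * x i) = d * cnj (y j)" if "j \<in> J" for j
      by (rule unit_maximizer_eq[OF fin(2) _ _ _ that])
         (use C max[OF C(1)] in \<open>auto simp: D_def d_def g2\<close>)
  qed
qed

section \<open>Maximal families of singular pairs\<close>

definition orthonormal_on :: "'i set \<Rightarrow> nat \<Rightarrow> (nat \<Rightarrow> 'i \<Rightarrow> complex) \<Rightarrow> bool" where
  "orthonormal_on I r x \<longleftrightarrow>
     (\<forall>k<r. \<forall>l<r. (\<Sum>i\<in>I. x k i * cnj (x l i)) = (if k = l then 1 else 0))"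

text \<open>Counts the total mass of the squared coordinates in two ways: each vector contributes 1,
  each coordinate at most 1. The bound makes the growth of singular families stop.\<close>

lemma orthonormal_on_card_le:
  fixes x :: "nat \<Rightarrow> 'i \<Rightarrow> complex"
  assumes "finite I"
    and x: "orthonormal_on I r x"
  shows "r \<le> card I"
proof -
  have orth: "(\<Sum>i\<in>I. x k i * cnj (x l i)) = (if k = l then 1 else 0)" if "k < r" "l < r" for k l
    using x that by (simp add: orthonormal_on_def)
  \<comment> \<open>Bessel's inequality for the standard basis vector at \<open>i\<close>; sum over \<open>i\<close>.\<close>
  have bessel: "(\<Sum>k<r. (cmod (x k i))\<^sup>2) \<le> 1" if "i \<in> I" for i
  proof -
    \<comment> \<open>\<open>z\<close> is the projection of the basis vector at \<open>i\<close>
      onto the span of the family. Its squared norm and its coordinate at \<open>i\<close> are both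
      \<open>b\<close>, so \<open>b^2 \<le> b\<close>.\<close>
    define z where "z = (\<lambda>j. \<Sum>k<r. cnj (x k i) * x k j)"
    define b where "b = (\<Sum>k<r. (cmod (x k i))\<^sup>2)"
    have zi: "z i = b"
      by (simp only: z_def b_def of_real_sum complex_norm_square mult.commute)
    have "(\<Sum>j\<in>I. z j * cnj (z j))
        = (\<Sum>j\<in>I. \<Sum>k<r. \<Sum>l<r. cnj (x k i) * x l i * (x k j * cnj (x l j)))"
      by (simp add: z_def sum_product mult_ac)
    also have "\<dots> = (\<Sum>k<r. \<Sum>l<r. \<Sum>j\<in>I. cnj (x k i) * x l i * (x k j * cnj (x l j)))"
      by (subst sum.swap, intro sum.cong refl, rule sum.swap)
    also have "\<dots> = (\<Sum>k<r. \<Sum>l<r. if k = l then cnj (x k i) * x l i else 0)"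
      by (intro sum.cong refl) (simp add: orth flip: sum_distrib_left)
    also have "\<dots> = b"
      by (simp add: b_def mult.commute complex_norm_square del: of_real_power)
    finally have "complex_of_real (\<Sum>j\<in>I. (cmod (z j))\<^sup>2) = b"
      by (simp add: complex_norm_square del: of_real_power)
    then have "(\<Sum>j\<in>I. (cmod (z j))\<^sup>2) = b"
      using of_real_eq_iff by blast
    moreover have "(cmod (z i))\<^sup>2 \<le> (\<Sum>j\<in>I. (cmod (z j))\<^sup>2)"
      using assms(1) that by (intro member_le_sum) auto
    ultimately have "b\<^sup>2 \<le> b" by (simp add: zi)
    then have "b \<le> 1"
      using mult_strict_left_mono[of 1 b b] by (cases "b \<le> 1") (auto simp: power2_eq_square)
    then show ?thesis by (simp add: b_def)
  qed
  have norm1: "(\<Sum>i\<in>I. (cmod (x k i))\<^sup>2) = 1" if "k < r" for k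
  proof -
    have "complex_of_real (\<Sum>i\<in>I. (cmod (x k i))\<^sup>2) = 1"
      using orth[OF that that] by (simp add: complex_norm_square del: of_real_power)
    then show ?thesis using of_real_eq_1_iff by blast
  qed
  have "real r = (\<Sum>k<r. \<Sum>i\<in>I. (cmod (x k i))\<^sup>2)"
    by (simp add: norm1)
  also have "\<dots> = (\<Sum>i\<in>I. \<Sum>k<r. (cmod (x k i))\<^sup>2)"
    by (rule sum.swap)
  also have "\<dots> \<le> (\<Sum>i\<in>I. 1)"
    by (intro sum_mono bessel)
  finally show ?thesis by simp
qed

text \<open>A partial singular value decomposition in bilinear form: \<open>K\<close> is applied to
  \<open>x\<close> and \<open>y\<close> without conjugation, so conjugates appear on the right, and
  it is the conjugated vectors that will expand \<open>K\<close>.\<close>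

definition singular_family ::
  "'i set \<Rightarrow> 'j set \<Rightarrow> ('i \<Rightarrow> 'j \<Rightarrow> complex) \<Rightarrow> nat \<Rightarrow> (nat \<Rightarrow> 'i \<Rightarrow> complex)
     \<Rightarrow> (nat \<Rightarrow> 'j \<Rightarrow> complex) \<Rightarrow> (nat \<Rightarrow> real) \<Rightarrow> bool" where
  "singular_family I J K r x y d \<longleftrightarrow> orthonormal_on I r x \<and> orthonormal_on J r y \<and>
     (\<forall>k<r. 0 \<le> d k \<and> (\<forall>i\<in>I. (\<Sum>j\<in>J. K i j * y k j) = d k * cnj (x k i)) \<and>
            (\<forall>j\<in>J. (\<Sum>i\<in>I. K i j * x k i) = d k * cnj (y k j)))"

lemma orthonormal_on_swap:
  assumes "orthonormal_on I r x" "k < r" "l < r"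
  shows "(\<Sum>i\<in>I. cnj (x k i) * x l i) = (if k = l then 1 else 0)"
proof -
  have "(\<Sum>i\<in>I. cnj (x k i) * x l i) = (\<Sum>i\<in>I. x l i * cnj (x k i))"
    by (simp only: mult.commute)
  then show ?thesis using assms by (auto simp: orthonormal_on_def)
qed

lemma orthonormal_on_extend:
  assumes "orthonormal_on I r x" "(\<Sum>i\<in>I. (cmod (z i))\<^sup>2) = 1"
    and "\<And>k. k < r \<Longrightarrow> (\<Sum>i\<in>I. x k i * cnj (z i)) = 0"
  shows "orthonormal_on I (Suc r) (x(r := z))"
proof -
  have "(\<Sum>i\<in>I. z i * cnj (z i)) = complex_of_real (\<Sum>i\<in>I. (cmod (z i))\<^sup>2)"
    by (simp add: complex_norm_square del: of_real_power)
  moreover have "(\<Sum>i\<in>I. z i * cnj (x k i)) = 0" if "k < r" for k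
  proof -
    have "(\<Sum>i\<in>I. z i * cnj (x k i)) = cnj (\<Sum>i\<in>I. x k i * cnj (z i))"
      by (simp only: cnj_sum complex_cnj_mult complex_cnj_cnj mult.commute)
    then show ?thesis using assms(3)[OF that] by simp
  qed
  ultimately show ?thesis
    using assms(1,3) unfolding orthonormal_on_def assms(2) by (simp add: less_Suc_eq all_conj_distrib disj_imp)
qed

text \<open>By orthonormality, only the \<open>k\<close>-th rank-one term acts on \<open>x k\<close>
  and \<open>y k\<close>, and there it agrees with \<open>K\<close>. The residual \<open>R\<close>
  therefore annihilates all directions found so far.\<close>

lemma singular_family_residual:
  assumes "singular_family I J K r x y d"
  defines "R \<equiv> \<lambda>i j. K i j - (\<Sum>k<r. d k * cnj (x k i) * cnj (y k j))"
  shows "k < r \<Longrightarrow> i \<in> I \<Longrightarrow> (\<Sum>j\<in>J. R i j * y k j) = 0"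
    and "k < r \<Longrightarrow> j \<in> J \<Longrightarrow> (\<Sum>i\<in>I. R i j * x k i) = 0"
proof -
  assume k: "k < r"
  have orth: "orthonormal_on I r x" "orthonormal_on J r y"
    and Ky: "\<And>i. i \<in> I \<Longrightarrow> (\<Sum>j\<in>J. K i j * y k j) = d k * cnj (x k i)"
    and Kx: "\<And>j. j \<in> J \<Longrightarrow> (\<Sum>i\<in>I. K i j * x k i) = d k * cnj (y k j)"
    using assms(1) k by (auto simp: singular_family_def)
  show "(\<Sum>j\<in>J. R i j * y k j) = 0" if "i \<in> I"
  proof -
    have "(\<Sum>j\<in>J. (\<Sum>l<r. d l * cnj (x l i) * cnj (y l j)) * y k j)
        = (\<Sum>l<r. d l * cnj (x l i) * (\<Sum>j\<in>J. cnj (y l j) * y k j))"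
      by (simp only: sum_distrib_left sum_distrib_right, subst sum.swap) (simp only: mult.assoc)
    also have "\<dots> = (\<Sum>l<r. if l = k then d l * cnj (x l i) else 0)"
      using orth k by (intro sum.cong refl) (auto simp: orthonormal_on_swap)
    also have "\<dots> = d k * cnj (x k i)" using k by simp
    finally show ?thesis
      using Ky[OF that] by (simp add: R_def left_diff_distrib sum_subtractf)
  qed
  show "(\<Sum>i\<in>I. R i j * x k i) = 0" if "j \<in> J"
  proof -
    have "(\<Sum>i\<in>I. (\<Sum>l<r. d l * cnj (x l i) * cnj (y l j)) * x k i)
        = (\<Sum>l<r. d l * cnj (y l j) * (\<Sum>i\<in>I. cnj (x l i) * x k i))"
      by (simp only: sum_distrib_left sum_distrib_right, subst sum.swap) (simp only: mult_ac)
    also have "\<dots> = (\<Sum>l<r. if l = k then d l * cnj (y l j) else 0)"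
      using orth k by (intro sum.cong refl) (auto simp: orthonormal_on_swap)
    also have "\<dots> = d k * cnj (y k j)" using k by simp
    finally show ?thesis
      using Kx[OF that] by (simp add: R_def left_diff_distrib sum_subtractf)
  qed
qed

text \<open>A singular pair \<open>u\<close>, \<open>v\<close> of the nonzero residual is the new
  member. As \<open>R\<close> annihilates the old directions and \<open>e > 0\<close>, the pair is
  orthogonal to them; hence the subtracted terms vanish on it and it is a singular pair of
  \<open>K\<close> as well.\<close>

lemma singular_family_extend:
  assumes fin: "finite I" "finite J" and sing: "singular_family I J K r x y d"
    and nz: "i0 \<in> I" "j0 \<in> J" "K i0 j0 \<noteq> (\<Sum>k<r. d k * cnj (x k i0) * cnj (y k j0))"
  shows "\<exists>x y d. singular_family I J K (Suc r) x y d"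
proof -
  define R where "R = (\<lambda>i j. K i j - (\<Sum>k<r. d k * cnj (x k i) * cnj (y k j)))"
  have res: "k < r \<Longrightarrow> i \<in> I \<Longrightarrow> (\<Sum>j\<in>J. R i j * y k j) = 0"
    "k < r \<Longrightarrow> j \<in> J \<Longrightarrow> (\<Sum>i\<in>I. R i j * x k i) = 0" for i j k
    using singular_family_residual[OF sing] unfolding R_def by blast+
  have "R i0 j0 \<noteq> 0" using nz by (simp add: R_def)
  obtain u v and e :: real where e: "e > 0"
    and u1: "(\<Sum>i\<in>I. (cmod (u i))\<^sup>2) = 1" and v1: "(\<Sum>j\<in>J. (cmod (v j))\<^sup>2) = 1"
    and u: "\<And>i. i \<in> I \<Longrightarrow> (\<Sum>j\<in>J. R i j * v j) = e * cnj (u i)"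
    and v: "\<And>j. j \<in> J \<Longrightarrow> (\<Sum>i\<in>I. R i j * u i) = e * cnj (v j)"
    by (rule exists_singular_pair[where K = R, OF fin nz(1,2) \<open>R i0 j0 \<noteq> 0\<close>]) (rule that; assumption)
  have ux: "(\<Sum>i\<in>I. x k i * cnj (u i)) = 0" if "k < r" for k
  proof -
    have "e * (\<Sum>i\<in>I. x k i * cnj (u i)) = (\<Sum>i\<in>I. x k i * (e * cnj (u i)))"
      by (simp add: sum_distrib_left mult_ac)
    also have "\<dots> = (\<Sum>i\<in>I. x k i * (\<Sum>j\<in>J. R i j * v j))"
      by (intro sum.cong refl) (simp only: u)
    also have "\<dots> = (\<Sum>j\<in>J. v j * (\<Sum>i\<in>I. R i j * x k i))"
      by (simp only: sum_distrib_left, subst sum.swap) (simp only: mult_ac)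
    also have "\<dots> = 0" using res(2)[OF that] by simp
    finally show ?thesis using e by simp
  qed
  have vy: "(\<Sum>j\<in>J. y k j * cnj (v j)) = 0" if "k < r" for k
  proof -
    have "e * (\<Sum>j\<in>J. y k j * cnj (v j)) = (\<Sum>j\<in>J. y k j * (e * cnj (v j)))"
      by (simp add: sum_distrib_left mult_ac)
    also have "\<dots> = (\<Sum>j\<in>J. y k j * (\<Sum>i\<in>I. R i j * u i))"
      by (intro sum.cong refl) (simp only: v)
    also have "\<dots> = (\<Sum>i\<in>I. u i * (\<Sum>j\<in>J. R i j * y k j))"
      by (simp only: sum_distrib_left, subst sum.swap) (simp only: mult_ac)
    also have "\<dots> = 0" using res(1)[OF that] by simp
    finally show ?thesis using e by simp
  qed
  have Kv: "(\<Sum>j\<in>J. K i j * v j) = e * cnj (u i)" if "i \<in> I" for i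
  proof -
    have "(\<Sum>j\<in>J. (\<Sum>l<r. d l * cnj (x l i) * cnj (y l j)) * v j)
        = (\<Sum>l<r. d l * cnj (x l i) * cnj (\<Sum>j\<in>J. y l j * cnj (v j)))"
      by (simp only: sum_distrib_left sum_distrib_right cnj_sum complex_cnj_mult complex_cnj_cnj, subst sum.swap) (simp only: mult_ac)
    also have "\<dots> = 0" by (simp add: vy)
    finally show ?thesis
      using u[OF that] by (simp add: R_def left_diff_distrib sum_subtractf)
  qed
  have Ku: "(\<Sum>i\<in>I. K i j * u i) = e * cnj (v j)" if "j \<in> J" for j
  proof -
    have "(\<Sum>i\<in>I. (\<Sum>l<r. d l * cnj (x l i) * cnj (y l j)) * u i)
        = (\<Sum>l<r. d l * cnj (y l j) * cnj (\<Sum>i\<in>I. x l i * cnj (u i)))"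
      by (simp only: sum_distrib_left sum_distrib_right cnj_sum complex_cnj_mult complex_cnj_cnj, subst sum.swap) (simp only: mult_ac)
    also have "\<dots> = 0" by (simp add: ux)
    finally show ?thesis
      using v[OF that] by (simp add: R_def left_diff_distrib sum_subtractf)
  qed
  have "singular_family I J K (Suc r) (x(r := u)) (y(r := v)) (d(r := e))"
    using sing Kv Ku e orthonormal_on_extend[OF _ u1 ux] orthonormal_on_extend[OF _ v1 vy]
    unfolding singular_family_def by (auto simp: less_Suc_eq)
  then show ?thesis by blast
qed

text \<open>Take a singular family of greatest length. A nonzero entry of the residual would allow
  an extension, so the residual is 0.\<close>

lemma schmidt_decomposition:
  fixes K :: "'i \<Rightarrow> 'j \<Rightarrow> complex"
  assumes fin: "finite I" "finite J"
  obtains r and u :: "nat \<Rightarrow> 'i \<Rightarrow> complex" and v :: "nat \<Rightarrow> 'j \<Rightarrow> complex"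
    and d :: "nat \<Rightarrow> real" where "orthonormal_on I r u" "orthonormal_on J r v"
    "\<And>k. k < r \<Longrightarrow> 0 \<le> d k"
    "\<And>i j. i \<in> I \<Longrightarrow> j \<in> J \<Longrightarrow> K i j = (\<Sum>k<r. d k * u k i * v k j)"
proof -
  define P where "P = (\<lambda>r. \<exists>x y d. singular_family I J K r x y d)"
  have "P 0" by (auto simp: P_def singular_family_def orthonormal_on_def)
  moreover have bound: "r \<le> card I" if "P r" for r
  proof -
    obtain x where "orthonormal_on I r x"
      using \<open>P r\<close> by (auto simp: P_def singular_family_def)
    then show ?thesis
      by (rule orthonormal_on_card_le[OF fin(1)])
  qed
  ultimately have g: "P (Greatest P)" "\<not> P (Suc (Greatest P))"
    using GreatestI_nat[of P 0 "card I"] Greatest_le_nat[of P "Suc (Greatest P)" "card I"] by auto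
  define r where "r = Greatest P"
  obtain x y d where sing: "singular_family I J K r x y d"
    using g(1) by (auto simp: P_def r_def)
  have K: "K i j = (\<Sum>k<r. d k * cnj (x k i) * cnj (y k j))" if "i \<in> I" "j \<in> J" for i j
    using singular_family_extend[OF fin sing that] g(2) by (auto simp: P_def r_def)
  have orth: "orthonormal_on I r (\<lambda>k i. cnj (x k i))" "orthonormal_on J r (\<lambda>k i. cnj (y k i))"
    using sing by (auto simp: singular_family_def orthonormal_on_swap orthonormal_on_def mult.commute[of "cnj _"])
  have "0 \<le> d k" if "k < r" for k
    using sing that by (simp add: singular_family_def)
  from that[OF orth this K] show thesis .
qed

subsection \<open>Positive semidefinite kernels\<close>

text \<open>Plain functions on an index set, so that induction over the set and compression to
  another set involve no matrix dimensions.\<close>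

definition psd_kernel :: "'i set \<Rightarrow> ('i \<Rightarrow> 'i \<Rightarrow> complex) \<Rightarrow> bool" where
  "psd_kernel I A \<longleftrightarrow> (\<forall>k\<in>I. \<forall>l\<in>I. A l k = cnj (A k l)) \<and>
     (\<forall>v. 0 \<le> Re (\<Sum>k\<in>I. \<Sum>l\<in>I. cnj (v k) * A k l * v l))"

lemma psd_kernelD:
  assumes "psd_kernel I A"
  shows "k \<in> I \<Longrightarrow> l \<in> I \<Longrightarrow> A l k = cnj (A k l)"
    and "0 \<le> Re (\<Sum>k\<in>I. \<Sum>l\<in>I. cnj (v k) * A k l * v l)"
  using assms unfolding psd_kernel_def by blast+

lemma quadratic_form_insert:
  fixes A :: "'i \<Rightarrow> 'i \<Rightarrow> complex"
  assumes "finite F" "i \<notin> F"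
  shows "(\<Sum>k\<in>insert i F. \<Sum>l\<in>insert i F. cnj (v k) * A k l * v l)
    = cnj (v i) * A i i * v i + cnj (v i) * (\<Sum>l\<in>F. A i l * v l) + (\<Sum>k\<in>F. cnj (v k) * A k i) * v i
      + (\<Sum>k\<in>F. \<Sum>l\<in>F. cnj (v k) * A k l * v l)"
proof -
  have "(\<Sum>k\<in>F. cnj (v k) * A k i * v i + (\<Sum>l\<in>F. cnj (v k) * A k l * v l))
    = (\<Sum>k\<in>F. cnj (v k) * A k i) * v i + (\<Sum>k\<in>F. \<Sum>l\<in>F. cnj (v k) * A k l * v l)"
    by (simp only: sum.distrib sum_distrib_right)
  moreover have "(\<Sum>l\<in>F. cnj (v i) * A i l * v l) = cnj (v i) * (\<Sum>l\<in>F. A i l * v l)"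
    by (simp only: sum_distrib_left mult.assoc)
  ultimately show ?thesis
    using assms by simp
qed

lemma psd_kernel_mono:
  assumes "psd_kernel I A" "F \<subseteq> I" "finite I"
  shows "psd_kernel F A"
  unfolding psd_kernel_def
proof (intro conjI allI ballI)
  show "A l k = cnj (A k l)" if "k \<in> F" "l \<in> F" for k l
    using psd_kernelD(1)[OF assms(1)] that assms(2) by blast
  fix v :: "'a \<Rightarrow> complex"
  define w where "w = (\<lambda>k. if k \<in> F then v k else 0)"
  have "(\<Sum>k\<in>F. \<Sum>l\<in>F. cnj (v k) * A k l * v l) = (\<Sum>k\<in>F. \<Sum>l\<in>F. cnj (w k) * A k l * w l)"
    by (simp add: w_def)
  also have "\<dots> = (\<Sum>k\<in>F. \<Sum>l\<in>I. cnj (w k) * A k l * w l)"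
    using assms(2,3) by (intro sum.cong refl sum.mono_neutral_left) (auto simp: w_def)
  also have "\<dots> = (\<Sum>k\<in>I. \<Sum>l\<in>I. cnj (w k) * A k l * w l)"
    using assms(2,3) by (intro sum.mono_neutral_left) (auto simp: w_def)
  finally show "0 \<le> Re (\<Sum>k\<in>F. \<Sum>l\<in>F. cnj (v k) * A k l * v l)"
    using psd_kernelD(2)[OF assms(1), of w] by simp
qed

text \<open>On the vector with entry \<open>- s * A i l\<close> at \<open>i\<close> and 1 at
  \<open>l\<close>, the form is affine in \<open>s\<close> because \<open>A i i = 0\<close>. It can
  be nonnegative for every real \<open>s\<close> only if its slope, a multiple of
  \<open>(cmod (A i l))^2\<close>, is 0.\<close>

lemma psd_kernel_zero_diagonal:
  assumes A: "psd_kernel (insert i F) A" and fin: "finite F" and l: "l \<in> F" "i \<notin> F"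
    and diag: "A i i = 0"
  shows "A i l = 0"
proof -
  have psd: "psd_kernel {i, l} A"
    using fin l(1) by (intro psd_kernel_mono[OF A]) auto
  have "Re (A l l) \<ge> 2 * s * (cmod (A i l))\<^sup>2" for s :: real
  proof -
    define v where "v = (\<lambda>k. if k = i then - s * A i l else 1)"
    have "0 \<le> Re (\<Sum>k\<in>{i, l}. \<Sum>m\<in>{i, l}. cnj (v k) * A k m * v m)"
      by (rule psd_kernelD(2)[OF psd])
    also have "(\<Sum>k\<in>{i, l}. \<Sum>m\<in>{i, l}. cnj (v k) * A k m * v m)
        = A l l - s * (A i l * cnj (A i l)) - s * (A i l * cnj (A i l))"
      using l diag psd_kernelD(1)[OF psd, of i l]
      by (subst quadratic_form_insert) (auto simp: v_def algebra_simps)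
    also have "Re \<dots> = Re (A l l) - 2 * s * (cmod (A i l))\<^sup>2"
      unfolding complex_norm_square[symmetric] by (simp del: of_real_power flip: of_real_mult)
    finally show ?thesis by simp
  qed
  \<comment> \<open>This \<open>s\<close> makes the lower bound equal to
    \<open>Re (A l l) + 1\<close>, which is absurd unless \<open>A i l = 0\<close>.\<close>
  from this[of "(Re (A l l) + 1) / (2 * (cmod (A i l))\<^sup>2)"] show ?thesis
    by (cases "A i l = 0") auto
qed

lemma psd_kernel_rank_one_sum:
  assumes "finite I" "psd_kernel I A"
  shows "\<exists>b :: 'i \<Rightarrow> 'i \<Rightarrow> complex. \<forall>k\<in>I. \<forall>l\<in>I. A k l = (\<Sum>r\<in>I. b r k * cnj (b r l))"
  using assms
proof (induction I arbitrary: A rule: finite_induct)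
  case empty
  then show ?case by simp
next
  case (insert i F)
  note herm = psd_kernelD(1)[OF insert.prems]
  have "A i i = Re (A i i)"
    using herm[of i i] by (simp add: complex_eq_iff)
  then obtain a :: real where a: "A i i = a" by blast
  have "psd_kernel {i} A"
    using insert by (auto intro: psd_kernel_mono)
  from psd_kernelD(2)[OF this, of "\<lambda>_. 1"] have "a \<ge> 0" by (simp add: a)
  \<comment> \<open>One step of the Cholesky decomposition: split off the column of \<open>i\<close>.\<close>
  define c where "c = (\<lambda>k. if a = 0 then 0 else A k i / sqrt a)"
  define A' where "A' = (\<lambda>k l. A k l - c k * cnj (c l))"
  have cc: "c k * cnj (c l) = (if a = 0 then 0 else A k i * A i l / a)"
    if "k \<in> insert i F" "l \<in> insert i F" for k l
    using \<open>a \<ge> 0\<close> herm[of l i] that by (auto simp: c_def simp flip: of_real_mult)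
  have row: "A' i l = 0" "A' l i = 0" if "l \<in> insert i F" for l
  proof -
    \<comment> \<open>With a zero pivot nothing is split off (\<open>c\<close> is 0), but then the
      row of \<open>i\<close> is already 0.\<close>
    have "A i l = 0" if "a = 0" "l \<in> F"
      using psd_kernel_zero_diagonal[OF insert.prems insert.hyps(1) that(2) insert.hyps(2)] a that(1) by simp
    then have *: "A i l = 0" if "a = 0"
      using that a \<open>l \<in> insert i F\<close> by auto
    show "A' i l = 0" using * that by (auto simp: A'_def cc a)
    show "A' l i = 0" using * that herm[of i l] by (auto simp: A'_def cc a)
  qed
  have "psd_kernel F A'"
    unfolding psd_kernel_def
  proof (intro conjI allI ballI)
    show "A' l k = cnj (A' k l)" if "k \<in> F" "l \<in> F" for k l
      using herm[of k l] that by (simp add: A'_def)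
    fix v :: "'i \<Rightarrow> complex"
    define s where "s = (\<Sum>l\<in>F. A i l * v l)"
    \<comment> \<open>Completing the square: for \<open>a > 0\<close> the entry at \<open>i\<close>
      minimises the form of \<open>A\<close> among extensions of \<open>v\<close>, and the minimum
      is the form of \<open>A'\<close> at \<open>v\<close>. So nonnegativity passes from
      \<open>A\<close> to the Schur complement \<open>A'\<close>.\<close>
    define w where "w = v(i := if a = 0 then 0 else - s / a)"
    have wF: "w k = v k" if "k \<in> F" for k
      using that insert.hyps by (auto simp: w_def)
    have s': "(\<Sum>k\<in>F. cnj (v k) * A k i) = cnj s"
      unfolding s_def cnj_sum using herm[of i]
      by (intro sum.cong refl) (auto simp: mult.commute)
    have "(\<Sum>k\<in>F. \<Sum>l\<in>F. cnj (v k) * (c k * cnj (c l)) * v l)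
        = (if a = 0 then 0 else cnj s * s / a)"
    proof -
      have "(\<Sum>k\<in>F. \<Sum>l\<in>F. cnj (v k) * (A k i * A i l / a) * v l)
        = (\<Sum>k\<in>F. cnj (v k) * A k i) * s / a"
        unfolding s_def sum_product sum_divide_distrib by (simp add: mult_ac)
      then show ?thesis by (simp add: cc s')
    qed
    then have "(\<Sum>k\<in>F. \<Sum>l\<in>F. cnj (v k) * A' k l * v l)
      = (\<Sum>k\<in>F. \<Sum>l\<in>F. cnj (v k) * A k l * v l) - (if a = 0 then 0 else cnj s * s / a)"
      by (simp only: A'_def right_diff_distrib left_diff_distrib sum_subtractf)
    also have "\<dots> = (\<Sum>k\<in>insert i F. \<Sum>l\<in>insert i F. cnj (w k) * A k l * w l)"
    proof -
      have "(\<Sum>k\<in>insert i F. \<Sum>l\<in>insert i F. cnj (w k) * A k l * w l)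
        = cnj (w i) * A i i * w i + cnj (w i) * s + cnj s * w i
          + (\<Sum>k\<in>F. \<Sum>l\<in>F. cnj (v k) * A k l * v l)"
        using quadratic_form_insert[OF insert.hyps, of w A] by (simp only: wF s' flip: s_def cong: sum.cong)
      then show ?thesis by (simp add: w_def a)
    qed
    finally show "0 \<le> Re (\<Sum>k\<in>F. \<Sum>l\<in>F. cnj (v k) * A' k l * v l)"
      using psd_kernelD(2)[OF insert.prems, of w] by simp
  qed
  then obtain b where b: "\<forall>k\<in>F. \<forall>l\<in>F. A' k l = (\<Sum>r\<in>F. b r k * cnj (b r l))"
    using insert.IH by blast
  \<comment> \<open>Row and column \<open>i\<close> of \<open>A'\<close> vanish, so the vectors
    obtained for \<open>F\<close> are extended by 0 at \<open>i\<close>; the new summand is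
    \<open>c\<close>.\<close>
  define b' where "b' = (\<lambda>r. if r = i then c else (b r)(i := 0))"
  have "A k l = (\<Sum>r\<in>insert i F. b' r k * cnj (b' r l))"
    if "k \<in> insert i F" "l \<in> insert i F" for k l
  proof -
    have "(\<Sum>r\<in>F. b' r k * cnj (b' r l)) = (\<Sum>r\<in>F. ((b r)(i := 0)) k * cnj (((b r)(i := 0)) l))"
      using insert.hyps by (intro sum.cong) (auto simp: b'_def)
    also have "\<dots> = A' k l"
      using b row that insert.hyps by (cases "k = i"; cases "l = i") auto
    finally show ?thesis
      using insert.hyps by (simp add: b'_def A'_def)
  qed
  then show ?case by blast
qed

text \<open>With \<open>D = diag(d)\<close> the sum is the trace of \<open>D A D B\<close>.
  Expanding \<open>B\<close> into rank-one terms turns it into a sum of values of the quadratic form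
  of \<open>A\<close>, at the vectors with entries \<open>d k * b r k\<close>.\<close>

lemma psd_kernel_trace_nonneg:
  fixes A B :: "'i \<Rightarrow> 'i \<Rightarrow> complex" and d :: "'i \<Rightarrow> real"
  assumes "finite I" "psd_kernel I A" "psd_kernel I B"
  shows "0 \<le> Re (\<Sum>k\<in>I. \<Sum>l\<in>I. d k * d l * A k l * B l k)"
proof -
  obtain b where b: "\<forall>k\<in>I. \<forall>l\<in>I. B k l = (\<Sum>r\<in>I. b r k * cnj (b r l))"
    using psd_kernel_rank_one_sum[OF assms(1,3)] by blast
  have "(\<Sum>k\<in>I. \<Sum>l\<in>I. d k * d l * A k l * B l k)
      = (\<Sum>k\<in>I. \<Sum>l\<in>I. \<Sum>r\<in>I. cnj (d k * b r k) * A k l * (d l * b r l))"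
    using b by (intro sum.cong refl) (auto simp: sum_distrib_left intro!: sum.cong)
  also have "\<dots> = (\<Sum>k\<in>I. \<Sum>r\<in>I. \<Sum>l\<in>I. cnj (d k * b r k) * A k l * (d l * b r l))"
    by (rule sum.cong[OF refl], rule sum.swap)
  also have "\<dots> = (\<Sum>r\<in>I. \<Sum>k\<in>I. \<Sum>l\<in>I. cnj (d k * b r k) * A k l * (d l * b r l))"
    by (rule sum.swap)
  finally have "Re (\<Sum>k\<in>I. \<Sum>l\<in>I. d k * d l * A k l * B l k)
      = (\<Sum>r\<in>I. Re (\<Sum>k\<in>I. \<Sum>l\<in>I. cnj (d k * b r k) * A k l * (d l * b r l)))"
    by (simp only: Re_sum)
  then show ?thesis
    using psd_kernelD(2)[OF assms(2)] by (simp only: sum_nonneg)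
qed

lemma psd_kernel_transpose:
  assumes "psd_kernel I A"
  shows "psd_kernel I (\<lambda>k l. A l k)"
  unfolding psd_kernel_def
proof (intro conjI allI ballI)
  show "A k l = cnj (A l k)" if "k \<in> I" "l \<in> I" for k l
    using psd_kernelD(1)[OF assms that(2,1)] .
  fix v :: "'a \<Rightarrow> complex"
  have "(\<Sum>k\<in>I. \<Sum>l\<in>I. cnj (v k) * A l k * v l) = (\<Sum>k\<in>I. \<Sum>l\<in>I. cnj (cnj (v k)) * A k l * cnj (v l))"
    by (subst sum.swap) (simp add: mult_ac)
  then show "0 \<le> Re (\<Sum>k\<in>I. \<Sum>l\<in>I. cnj (v k) * A l k * v l)"
    using psd_kernelD(2)[OF assms, of "\<lambda>k. cnj (v k)"] by simp
qed

lemma sum_swap_pairs: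
  "(\<Sum>k\<in>K. \<Sum>l\<in>L. \<Sum>i\<in>I. \<Sum>j\<in>J. f k l i j) = (\<Sum>i\<in>I. \<Sum>j\<in>J. \<Sum>k\<in>K. \<Sum>l\<in>L. f k l i j)"
proof -
  have "(\<Sum>k\<in>K. \<Sum>l\<in>L. \<Sum>i\<in>I. \<Sum>j\<in>J. f k l i j) = (\<Sum>k\<in>K. \<Sum>i\<in>I. \<Sum>j\<in>J. \<Sum>l\<in>L. f k l i j)"
    by (intro sum.cong refl, subst sum.swap, intro sum.cong refl, rule sum.swap)
  also have "\<dots> = (\<Sum>i\<in>I. \<Sum>j\<in>J. \<Sum>k\<in>K. \<Sum>l\<in>L. f k l i j)"
    by (subst sum.swap, intro sum.cong refl, rule sum.swap)
  finally show ?thesis .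
qed

text \<open>With the \<open>u l\<close> as columns of a matrix \<open>U\<close>, this kernel is
  \<open>U* A U\<close>, whose form at \<open>v\<close> is the form of \<open>A\<close> at
  \<open>U v\<close>.\<close>

lemma psd_kernel_compress:
  assumes "psd_kernel I A"
  shows "psd_kernel K (\<lambda>k l. \<Sum>i\<in>I. \<Sum>j\<in>I. cnj (u k i) * A i j * u l j)"
  unfolding psd_kernel_def
proof (intro conjI allI ballI)
  show "(\<Sum>i\<in>I. \<Sum>j\<in>I. cnj (u l i) * A i j * u k j) = cnj (\<Sum>i\<in>I. \<Sum>j\<in>I. cnj (u k i) * A i j * u l j)"
    for k l
  proof -
    have "cnj (\<Sum>i\<in>I. \<Sum>j\<in>I. cnj (u k i) * A i j * u l j)
        = (\<Sum>i\<in>I. \<Sum>j\<in>I. u k i * A j i * cnj (u l j))"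
      unfolding cnj_sum by (intro sum.cong refl) (simp flip: psd_kernelD(1)[OF assms])
    also have "\<dots> = (\<Sum>j\<in>I. \<Sum>i\<in>I. u k i * A j i * cnj (u l j))"
      by (rule sum.swap)
    finally show ?thesis by (simp add: mult_ac)
  qed
  fix v :: "'b \<Rightarrow> complex"
  define w where "w = (\<lambda>i. \<Sum>k\<in>K. u k i * v k)"
  have "(\<Sum>k\<in>K. \<Sum>l\<in>K. cnj (v k) * (\<Sum>i\<in>I. \<Sum>j\<in>I. cnj (u k i) * A i j * u l j) * v l)
      = (\<Sum>k\<in>K. \<Sum>l\<in>K. \<Sum>i\<in>I. \<Sum>j\<in>I. cnj (u k i * v k) * A i j * (u l j * v l))"
    by (simp add: sum_distrib_left sum_distrib_right mult_ac)
  also have "\<dots> = (\<Sum>i\<in>I. \<Sum>j\<in>I. \<Sum>k\<in>K. \<Sum>l\<in>K. cnj (u k i * v k) * A i j * (u l j * v l))"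
    by (rule sum_swap_pairs)
  also have "\<dots> = (\<Sum>i\<in>I. \<Sum>j\<in>I. cnj (w i) * A i j * w j)"
    by (simp add: w_def sum_distrib_left sum_distrib_right mult_ac)
  finally show "0 \<le> Re (\<Sum>k\<in>K. \<Sum>l\<in>K. cnj (v k) * (\<Sum>i\<in>I. \<Sum>j\<in>I. cnj (u k i) * A i j * u l j) * v l)"
    using psd_kernelD(2)[OF assms, of w] by simp
qed

subsection \<open>From doubly nonnegative matrices to NPA certificates\<close>

text \<open>Along the line \<open>v + t w\<close> with \<open>w = X v\<close> the form is
  \<open>2 t N + t^2 q\<close>. Near \<open>t = 0\<close> the linear term dominates, so
  nonnegativity forces \<open>N\<close>, the squared norm of \<open>w\<close>, to be 0.\<close>

lemma psd_matrices_null_vector: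
  assumes X: "X \<in> psd_matrices" and v: "inner v (X *v v) = 0"
  shows "X *v v = 0"
proof -
  define w where "w = X *v v"
  define N where "N = inner w w"
  define q where "q = inner w (X *v w)"
  have sym: "inner u (X *v z) = inner (X *v u) z" for u z
    using X dot_lmul_matrix[of u X z] by (simp add: psd_matrices_def flip: transpose_matrix_vector)
  have form: "0 \<le> 2 * t * N + t\<^sup>2 * q" for t
  proof -
    have "0 \<le> inner (v + t *\<^sub>R w) (X *v (v + t *\<^sub>R w))"
      using X by (simp add: psd_matrices_def)
    also have "\<dots> = 2 * t * N + t\<^sup>2 * q"
      using v sym[of v w]
      by (simp add: matrix_vector_right_distrib matrix_vector_mult_scaleR inner_add_left inner_add_right
          N_def q_def w_def[symmetric] power2_eq_square algebra_simps)
    finally show ?thesis .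
  qed
  have "q \<ge> 0" using X by (simp add: psd_matrices_def q_def)
  \<comment> \<open>The parameter \<open>t = - N * r\<close> gives the value
    \<open>- N^2 r (1 + r)\<close>, negative unless \<open>N = 0\<close>; the 1 in the denominator
    covers \<open>q = 0\<close>.\<close>
  define r where "r = 1 / (q + 1)"
  have r: "r > 0" "r * q = 1 - r"
    using \<open>q \<ge> 0\<close> by (auto simp: r_def field_simps)
  have "0 \<le> 2 * (- N * r) * N + (- N * r)\<^sup>2 * q"
    by (rule form)
  also have "\<dots> = - 2 * N\<^sup>2 * r + N\<^sup>2 * r * (r * q)"
    by (simp add: power2_eq_square algebra_simps)
  also have "\<dots> = - (N\<^sup>2 * (r * (1 + r)))"
    unfolding r(2) by (simp add: algebra_simps)
  finally have "N = 0"
    using r(1) by (simp add: mult_le_0_iff)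
  then show ?thesis by (simp add: N_def w_def)
qed

text \<open>The sum of \<open>W x y * (w x - w y)^2\<close> is nonnegative and expands to twice the
  difference of the two sides.\<close>

lemma laplacian_form_nonneg:
  fixes W :: "'i \<Rightarrow> 'i \<Rightarrow> real"
  assumes sym: "\<And>x y. W x y = W y x" and nonneg: "\<And>x y. 0 \<le> W x y"
  shows "(\<Sum>x\<in>I. \<Sum>y\<in>I. W x y * w x * w y) \<le> (\<Sum>x\<in>I. (\<Sum>y\<in>I. W x y) * (w x)\<^sup>2)"
proof -
  have "0 \<le> (\<Sum>x\<in>I. \<Sum>y\<in>I. W x y * (w x - w y)\<^sup>2)"
    using nonneg by (intro sum_nonneg mult_nonneg_nonneg) auto
  also have "\<dots> = (\<Sum>x\<in>I. \<Sum>y\<in>I. W x y * (w x)\<^sup>2) + (\<Sum>x\<in>I. \<Sum>y\<in>I. W x y * (w y)\<^sup>2)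
      - 2 * (\<Sum>x\<in>I. \<Sum>y\<in>I. W x y * w x * w y)"
    by (simp add: power2_diff algebra_simps sum.distrib sum_subtractf sum_distrib_left)
  also have "(\<Sum>x\<in>I. \<Sum>y\<in>I. W x y * (w y)\<^sup>2) = (\<Sum>x\<in>I. \<Sum>y\<in>I. W x y * (w x)\<^sup>2)"
    by (subst sum.swap) (simp add: sym[of _ ])
  finally show ?thesis by (simp add: sum_distrib_right)
qed

section \<open>The objective and the sums over blocks\<close>

lemma sum_UNIV_plus:
  fixes f :: "'a::finite + 'b::finite \<Rightarrow> 'c::comm_monoid_add"
  shows "(\<Sum>z\<in>UNIV. f z) = (\<Sum>x\<in>UNIV. f (Inl x)) + (\<Sum>y\<in>UNIV. f (Inr y))"
  by (subst UNIV_Plus_UNIV[symmetric], subst sum.Plus) (simp_all add: o_def)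

lemma sum_UNIV_prod:
  fixes f :: "'a::finite \<times> 'b::finite \<Rightarrow> 'c::comm_monoid_add"
  shows "(\<Sum>z\<in>UNIV. f z) = (\<Sum>x\<in>UNIV. \<Sum>y\<in>UNIV. f (x, y))"
  by (simp add: sum.cartesian_product flip: UNIV_Times_UNIV)

text \<open>By symmetry of \<open>X\<close> the two off-diagonal blocks contribute equally, which
  cancels the factor 1/2. The trace is thus the winning probability of the off-diagonal part of
  \<open>X\<close>.\<close>

lemma trace_symm_cost_matrix:
  assumes "transpose X = X"
  shows "trace (symm_cost_matrix \<pi> V ** X) = win \<pi> V (\<lambda>a b s t. X $ Inl (s, a) $ Inr (t, b))"
proof -
  have sym: "X $ j $ i = X $ i $ j" for i j
    using arg_cong[OF assms, of "\<lambda>M. M $ i $ j"] by (simp add: transpose_def)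
  have "trace (symm_cost_matrix \<pi> V ** X)
      = (\<Sum>i\<in>UNIV. \<Sum>j\<in>UNIV. symm_cost_matrix \<pi> V $ i $ j * X $ i $ j)"
    by (simp add: trace_def matrix_matrix_mult_def sym)
  also have "\<dots> = (\<Sum>x\<in>UNIV. \<Sum>y\<in>UNIV. cost_matrix \<pi> V $ x $ y / 2 * X $ Inl x $ Inr y)
      + (\<Sum>y\<in>UNIV. \<Sum>x\<in>UNIV. cost_matrix \<pi> V $ x $ y / 2 * X $ Inr y $ Inl x)"
    by (simp add: sum_UNIV_plus symm_cost_matrix_def transpose_def)
  also have "(\<Sum>y\<in>UNIV. \<Sum>x\<in>UNIV. cost_matrix \<pi> V $ x $ y / 2 * X $ Inr y $ Inl x)
      = (\<Sum>x\<in>UNIV. \<Sum>y\<in>UNIV. cost_matrix \<pi> V $ x $ y / 2 * X $ Inl x $ Inr y)"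
    by (subst sum.swap) (simp add: sym)
  also have "(\<Sum>x\<in>UNIV. \<Sum>y\<in>UNIV. cost_matrix \<pi> V $ x $ y / 2 * X $ Inl x $ Inr y)
      + (\<Sum>x\<in>UNIV. \<Sum>y\<in>UNIV. cost_matrix \<pi> V $ x $ y / 2 * X $ Inl x $ Inr y)
      = (\<Sum>x\<in>UNIV. \<Sum>y\<in>UNIV. cost_matrix \<pi> V $ x $ y * X $ Inl x $ Inr y)"
    by (simp add: mult.commute flip: sum.distrib)
  also have "\<dots> = (\<Sum>s\<in>UNIV. \<Sum>a\<in>UNIV. \<Sum>t\<in>UNIV. \<Sum>b\<in>UNIV.
      pmf \<pi> (s, t) * (of_bool (V a b s t) * X $ Inl (s, a) $ Inr (t, b)))"
    by (simp add: sum_UNIV_prod cost_matrix_def mult.assoc)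
  also have "\<dots> = (\<Sum>s\<in>UNIV. \<Sum>t\<in>UNIV. \<Sum>a\<in>UNIV. \<Sum>b\<in>UNIV.
      pmf \<pi> (s, t) * (of_bool (V a b s t) * X $ Inl (s, a) $ Inr (t, b)))"
    by (rule sum.cong[OF refl], rule sum.swap)
  also have "\<dots> = win \<pi> V (\<lambda>a b s t. X $ Inl (s, a) $ Inr (t, b))"
    by (simp only: win_def sum_distrib_left)
  finally show ?thesis .
qed

text \<open>The blocks are the fibres of this map, so block sums become sums over all indices with a
  condition on \<open>question\<close>.\<close>

fun question :: "('a, 'b, 's, 't) index \<Rightarrow> 's + 't" where
  "question (Inl (s, a)) = Inl s"
| "question (Inr (t, b)) = Inr t"

lemma block_eq: "block i = {x. question x = i}"
proof (cases i)
  case (Inl s)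
  then show ?thesis by (auto elim!: question.elims)
next
  case (Inr t)
  then show ?thesis by (auto elim!: question.elims)
qed

lemma sum_block_Inl:
  fixes f :: "('a::finite, 'b::finite, 's::finite, 't::finite) index \<Rightarrow> 'c::comm_monoid_add"
  shows "(\<Sum>x\<in>block (Inl s). f x) = (\<Sum>a\<in>UNIV. f (Inl (s, a)))"
proof -
  have "block (Inl s) = (\<lambda>a. Inl (s, a) :: ('a, 'b, 's, 't) index) ` UNIV" by auto
  then show ?thesis by (simp only: sum.reindex inj_on_def) (simp add: sum.reindex inj_on_def)
qed

lemma sum_block_Inr:
  fixes f :: "('a::finite, 'b::finite, 's::finite, 't::finite) index \<Rightarrow> 'c::comm_monoid_add"
  shows "(\<Sum>x\<in>block (Inr t). f x) = (\<Sum>b\<in>UNIV. f (Inr (t, b)))"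
proof -
  have "block (Inr t) = (\<lambda>b. Inr (t, b) :: ('a, 'b, 's, 't) index) ` UNIV" by auto
  then show ?thesis by (simp only: sum.reindex inj_on_def) (simp add: sum.reindex inj_on_def)
qed

lemma sum_block_if:
  fixes f :: "('a::finite, 'b::finite, 's::finite, 't::finite) index \<Rightarrow> real"
  shows "(\<Sum>x\<in>block i. f x) = (\<Sum>x\<in>UNIV. if question x = i then f x else 0)"
  unfolding block_eq by (simp add: sum.If_cases)

text \<open>The difference of two block indicators has value \<open>1 - 1 - 1 + 1 = 0\<close> under the quadratic form, so
  it lies in the kernel of \<open>X\<close>.\<close>

lemma feasible_row_sums:
  fixes X :: "real ^ ('a::finite, 'b::finite, 's::finite, 't::finite) index ^ ('a, 'b, 's, 't) index"
  assumes X: "X \<in> psd_matrices" and blocks: "\<And>i j. block_sum i j X = 1"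
  shows "(\<Sum>y\<in>block i. X $ x $ y) = (\<Sum>y\<in>block j. X $ x $ y)"
proof -
  define e where "e = (\<lambda>i. (\<chi> x. if question x = i then 1 else 0) :: real ^ ('a, 'b, 's, 't) index)"
  have Xe: "(X *v e i) $ x = (\<Sum>y\<in>block i. X $ x $ y)" for i x
    by (simp add: matrix_vector_mult_def e_def sum_block_if if_distrib cong: if_cong)
  have eXe: "inner (e i) (X *v e j) = 1" for i j
    using blocks[of i j] unfolding block_sum_def inner_vec_def Xe
    by (simp add: sum_block_if e_def if_distrib if_distribR cong: if_cong)
  have "inner (e i - e j) (X *v (e i - e j)) = 0"
    by (simp add: matrix_vector_mult_diff_distrib inner_diff_left inner_diff_right eXe)
  then have "X *v (e i - e j) = 0"
    by (rule psd_matrices_null_vector[OF X])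
  then have "X *v e i = X *v e j"
    by (simp add: matrix_vector_mult_diff_distrib)
  then show ?thesis by (simp flip: Xe)
qed

lemma marginal_A_eqI:
  assumes "\<And>t. (\<Sum>b\<in>UNIV. p a b s t) = x"
  shows "marginal_A p a s = x"
  using assms unfolding marginal_A_def by auto

lemma marginal_B_eqI:
  assumes "\<And>s. (\<Sum>a\<in>UNIV. p a b s t) = x"
  shows "marginal_B p b t = x"
  using assms unfolding marginal_B_def by auto

section \<open>The NPA certificate of a feasible matrix\<close>

lemma quadratic_form_expand:
  fixes M :: "real ^ 'n ^ 'n"
  shows "inner v (M *v v) = (\<Sum>i\<in>UNIV. \<Sum>j\<in>UNIV. M $ i $ j * v $ i * v $ j)"
  by (simp add: inner_vec_def matrix_vector_mult_def sum_distrib_left mult_ac)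

lemma dnn_feasible_npa1:
  fixes X :: "real ^ ('a::finite, 'b::finite, 's::finite, 't::finite) index ^ ('a, 'b, 's, 't) index"
  assumes X: "X \<in> dnn_matrices" and blocks: "\<And>i j. block_sum i j X = 1"
  defines "p \<equiv> \<lambda>a b s t. X $ Inl (s, a) $ Inr (t, b)"
  shows "p \<in> npa1"
proof -
  have psd: "X \<in> psd_matrices" and nonneg: "\<And>i j. 0 \<le> X $ i $ j" and trans: "transpose X = X"
    using X by (auto simp: dnn_matrices_def psd_matrices_def)
  have sym: "X $ j $ i = X $ i $ j" for i j
    using arg_cong[OF trans, of "\<lambda>M. M $ i $ j"] by (simp add: transpose_def)
  \<comment> \<open>An arbitrary reference block: by \<open>feasible_row_sums\<close> the row sums
    \<open>g\<close> are the same for every block.\<close>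
  define i0 where "i0 = (undefined :: 's + 't)"
  define g where "g = (\<lambda>x. \<Sum>y\<in>block i0. X $ x $ y)"
  have g: "(\<Sum>y\<in>block i. X $ x $ y) = g x" for i x
    unfolding g_def by (rule feasible_row_sums[OF psd blocks])
  \<comment> \<open>Row sums over a block of the other player are the marginals; their independence
    of the block is exactly the no-signalling condition.\<close>
  have rowA: "(\<Sum>b\<in>UNIV. p a b s t) = g (Inl (s, a))" for a s t
    using g[of _ "Inr t"] by (simp add: p_def sum_block_Inr del: block.simps)
  have rowB: "(\<Sum>a\<in>UNIV. p a b s t) = g (Inr (t, b))" for b s t
    using g[of _ "Inl s"] by (simp add: p_def sum_block_Inl sym[of "Inl _"] del: block.simps)
  have sum_g: "(\<Sum>x\<in>block i. g x) = 1" for i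
    using blocks[of i i0] by (simp add: block_sum_def g_def)
  have ns: "p \<in> no_signalling"
    using nonneg sum_g[of "Inl _"] unfolding no_signalling_def correlations_def
    by (auto simp: rowA rowB sum_block_Inl simp del: block.simps) (simp add: p_def)
  have mA: "marginal_A p a s = g (Inl (s, a))" for a s
    by (rule marginal_A_eqI[of p a s, OF rowA])
  have mB: "marginal_B p b t = g (Inr (t, b))" for b t
    by (rule marginal_B_eqI[of p b t, OF rowB])
  \<comment> \<open>Passing from \<open>X\<close> to \<open>H\<close> replaces each diagonal block by the diagonal matrix of its row sums. This
    adds the Laplacian of a graph with nonnegative edge weights, hence a psd matrix.\<close>
  define H where "H = (\<lambda>x y. if question x = question y then (if x = y then g x else 0) else X $ x $ y)"
  define X' where "X' = (\<chi> x y. H (Inl x) (Inl y))"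
  define Y' where "Y' = (\<chi> x y. H (Inr x) (Inr y))"
  define M where "M = npa_matrix p X' Y'"
  have symH: "H x y = H y x" for x y
    by (simp add: H_def sym)
  have M_Inl: "M $ Inl u $ Inl u' = 1" "M $ Inl u $ Inr x = g x" "M $ Inr x $ Inl u = g x" for u u' x
    by (auto simp: M_def npa_matrix_def mA mB split: sum.splits)
  have M_Inr: "M $ Inr x $ Inr y = H x y" for x y
    by (cases x; cases y) (auto simp: M_def npa_matrix_def X'_def Y'_def H_def p_def sym split: if_splits)
  have "transpose M = M"
  proof -
    have "M $ j $ i = M $ i $ j" for i j
      by (cases i; cases j) (auto simp: M_Inl M_Inr symH)
    then show ?thesis by (simp add: transpose_def vec_eq_iff)
  qed
  moreover have "0 \<le> inner v (M *v v)" for v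
  proof -
    define c where "c = v $ Inl ()"
    define w where "w = (\<lambda>x. v $ Inr x)"
    \<comment> \<open>\<open>g\<close> is the image under \<open>X\<close> of the indicator of block
      \<open>i0\<close>. Hence the form of \<open>X\<close> bordered by \<open>g\<close> and 1, at
      \<open>(c, w)\<close>, is the form of \<open>X\<close> at \<open>w\<close> plus
      \<open>c\<close> times that indicator.\<close>
    define u where "u = (\<chi> x. w x + (if question x = i0 then c else 0))"
    define W where "W = (\<lambda>x y. if question y = question x then X $ x $ y else 0)"
    have Wg: "(\<Sum>y\<in>UNIV. W x y) = g x" for x
      using g[of x "question x"] by (simp add: W_def sum_block_if)
    have lap: "(\<Sum>x\<in>UNIV. \<Sum>y\<in>UNIV. W x y * w x * w y) \<le> (\<Sum>x\<in>UNIV. g x * (w x)\<^sup>2)"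
      unfolding Wg[symmetric]
      by (rule laplacian_form_nonneg) (auto simp: W_def sym nonneg)
    have H_split: "H x y = X $ x $ y + (if x = y then g x else 0) - W x y" for x y
      by (auto simp: H_def W_def)
    have diag: "(\<Sum>x\<in>UNIV. \<Sum>y\<in>UNIV. (if x = y then g x else 0) * w x * w y) = (\<Sum>x\<in>UNIV. g x * (w x)\<^sup>2)"
      by (simp add: power2_eq_square mult.assoc if_distrib[of "\<lambda>z. z * _"] cong: if_cong)
    have "inner v (M *v v) = c\<^sup>2 + 2 * c * (\<Sum>x\<in>UNIV. g x * w x) + (\<Sum>x\<in>UNIV. \<Sum>y\<in>UNIV. H x y * w x * w y)"
      unfolding quadratic_form_expand
      by (simp add: sum_UNIV_plus[where 'a = unit] M_Inl M_Inr UNIV_unit sum.distrib sum_distrib_left mult_ac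
          power2_eq_square c_def w_def)
    also have "(\<Sum>x\<in>UNIV. \<Sum>y\<in>UNIV. H x y * w x * w y)
        = (\<Sum>x\<in>UNIV. \<Sum>y\<in>UNIV. X $ x $ y * w x * w y) + (\<Sum>x\<in>UNIV. g x * (w x)\<^sup>2)
          - (\<Sum>x\<in>UNIV. \<Sum>y\<in>UNIV. W x y * w x * w y)"
      unfolding H_split
      by (simp add: left_diff_distrib distrib_right sum.distrib sum_subtractf diag)
    finally have "inner v (M *v v) \<ge> c\<^sup>2 + 2 * c * (\<Sum>x\<in>UNIV. g x * w x)
        + (\<Sum>x\<in>UNIV. \<Sum>y\<in>UNIV. X $ x $ y * w x * w y)"
      using lap by linarith
    moreover have "inner u (X *v u) = c\<^sup>2 + 2 * c * (\<Sum>x\<in>UNIV. g x * w x)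
        + (\<Sum>x\<in>UNIV. \<Sum>y\<in>UNIV. X $ x $ y * w x * w y)"
    proof -
      define k where "k = (\<lambda>x::('a, 'b, 's, 't) index. if question x = i0 then c else 0)"
      have k1: "(\<Sum>y\<in>UNIV. X $ x $ y * k y) = c * g x" for x
        by (simp add: k_def g_def sum_block_if sum_distrib_left if_distrib mult.commute cong: if_cong)
      have k2: "(\<Sum>x\<in>UNIV. k x * g x) = c"
      proof -
        have "(\<Sum>x\<in>UNIV. k x * g x) = (\<Sum>x\<in>block i0. c * g x)"
          by (simp add: k_def sum_block_if if_distrib if_distribR cong: if_cong)
        also have "\<dots> = c" by (simp add: sum_g flip: sum_distrib_left)
        finally show ?thesis .
      qed
      have "inner u (X *v u) = (\<Sum>x\<in>UNIV. \<Sum>y\<in>UNIV. X $ x $ y * (w x + k x) * (w y + k y))"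
        by (simp add: quadratic_form_expand u_def k_def)
      also have "\<dots> = (\<Sum>x\<in>UNIV. \<Sum>y\<in>UNIV. X $ x $ y * w x * w y) + (\<Sum>x\<in>UNIV. w x * (\<Sum>y\<in>UNIV. X $ x $ y * k y))
          + (\<Sum>x\<in>UNIV. \<Sum>y\<in>UNIV. X $ x $ y * k x * w y) + (\<Sum>x\<in>UNIV. k x * (\<Sum>y\<in>UNIV. X $ x $ y * k y))"
        by (simp add: algebra_simps sum.distrib sum_distrib_left)
      also have "(\<Sum>x\<in>UNIV. \<Sum>y\<in>UNIV. X $ x $ y * k x * w y) = (\<Sum>x\<in>UNIV. w x * (\<Sum>y\<in>UNIV. X $ x $ y * k y))"
        by (subst sum.swap) (simp add: sum_distrib_left sym mult_ac)
      finally have "inner u (X *v u) = (\<Sum>x\<in>UNIV. \<Sum>y\<in>UNIV. X $ x $ y * w x * w y)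
          + 2 * (\<Sum>x\<in>UNIV. w x * (c * g x)) + (\<Sum>x\<in>UNIV. k x * (c * g x))"
        by (simp add: k1)
      also have "(\<Sum>x\<in>UNIV. w x * (c * g x)) = c * (\<Sum>x\<in>UNIV. g x * w x)"
        by (simp only: sum_distrib_left mult_ac)
      also have "(\<Sum>x\<in>UNIV. k x * (c * g x)) = c * (\<Sum>x\<in>UNIV. k x * g x)"
        by (simp only: sum_distrib_left mult_ac)
      finally show ?thesis
        by (simp add: k2 power2_eq_square)
    qed
    moreover have "0 \<le> inner u (X *v u)"
      using psd by (simp add: psd_matrices_def)
    ultimately show ?thesis by linarith
  qed
  ultimately have "npa_matrix p X' Y' \<in> psd_matrices"
    by (simp add: psd_matrices_def M_def)
  moreover have "transpose X' = X'" "transpose Y' = Y'"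
    by (simp_all add: transpose_def X'_def Y'_def symH)
  moreover have "X' $ (s, a) $ (s, a') = (if a = a' then marginal_A p a s else 0)" for s a a'
    by (simp add: X'_def H_def mA)
  moreover have "Y' $ (t, b) $ (t, b') = (if b = b' then marginal_B p b t else 0)" for t b b'
    by (simp add: Y'_def H_def mB)
  ultimately show ?thesis
    using ns unfolding npa1_def by blast
qed

subsection \<open>From quantum strategies to doubly nonnegative matrices\<close>

lemma sum_nat_pairs:
  "(\<Sum>k<n * m. f k) = (\<Sum>i<n. \<Sum>j<m. f (i * m + j))" for n m :: nat
proof -
  have "(\<Sum>k<n * m. f k) = (\<Sum>i<n. \<Sum>k\<in>{i * m..<i * m + m}. f k)"
    by (rule sum.nat_group[symmetric])
  also have "\<dots> = (\<Sum>i<n. \<Sum>j<m. f (i * m + j))"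
  proof (rule sum.cong[OF refl])
    show "(\<Sum>k\<in>{i * m..<i * m + m}. f k) = (\<Sum>j<m. f (i * m + j))" for i
      using sum.shift_bounds_nat_ivl[of f 0 "i * m" m] by (simp add: atLeast0LessThan add.commute)
  qed
  finally show ?thesis .
qed

text \<open>\<open>K\<close> is the state reshaped into an \<open>n\<close> by \<open>m\<close>
  array along the numbering \<open>i * m + j\<close>, the array to which the Schmidt decomposition
  is applied.\<close>

lemma kronecker_form:
  assumes A: "A \<in> carrier_mat n n" and B: "B \<in> carrier_mat m m" and \<psi>: "\<psi> \<in> carrier_vec (n * m)"
  defines "K \<equiv> \<lambda>i j. vec_index \<psi> (i * m + j)"
  shows "(kronecker A B *\<^sub>v \<psi>) \<bullet>c \<psi>
    = (\<Sum>i<n. \<Sum>j<m. \<Sum>i'<n. \<Sum>j'<m. A $$ (i, i') * B $$ (j, j') * K i' j' * cnj (K i j))"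
proof -
  have lt: "i * m + j < n * m" if "i < n" "j < m" for i j
  proof -
    have "i * m + j < Suc i * m" using that by simp
    also have "\<dots> \<le> n * m" using that by (intro mult_le_mono1) simp
    finally show ?thesis .
  qed
  have "(kronecker A B *\<^sub>v \<psi>) \<bullet>c \<psi>
      = (\<Sum>k<n * m. \<Sum>l<n * m. kronecker A B $$ (k, l) * vec_index \<psi> l * cnj (vec_index \<psi> k))"
    using A B \<psi>
    by (simp add: scalar_prod_def kronecker_def row_def atLeast0LessThan sum_distrib_right)
  also have "\<dots> = (\<Sum>i<n. \<Sum>j<m. \<Sum>i'<n. \<Sum>j'<m. A $$ (i, i') * B $$ (j, j') * K i' j' * cnj (K i j))"
    unfolding sum_nat_pairs K_def
    using A B by (intro sum.cong refl) (simp add: kronecker_def lt)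
  finally show ?thesis .
qed

lemma hermitian_psd_kernel:
  assumes "hermitian_psd n M"
  shows "psd_kernel {..<n} (\<lambda>i j. M $$ (i, j))"
  unfolding psd_kernel_def
proof (intro conjI allI ballI)
  have M: "M \<in> carrier_mat n n" "mat_adjoint M = M"
    and psd: "\<And>v. v \<in> carrier_vec n \<Longrightarrow> 0 \<le> (M *\<^sub>v v) \<bullet>c v"
    using assms by (auto simp: hermitian_psd_def)
  show "M $$ (j, i) = cnj (M $$ (i, j))" if "i \<in> {..<n}" "j \<in> {..<n}" for i j
  proof -
    have "mat_adjoint M $$ (j, i) = cnj (M $$ (i, j))"
      using M(1) that by (simp add: mat_adjoint_def mat_of_rows_def)
    then show ?thesis by (simp add: M(2))
  qed
  fix v :: "nat \<Rightarrow> complex"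
  have "(M *\<^sub>v vec n v) \<bullet>c vec n v = (\<Sum>i<n. \<Sum>j<n. cnj (v i) * M $$ (i, j) * v j)"
    using M(1) by (simp add: scalar_prod_def row_def atLeast0LessThan sum_distrib_left mult_ac)
  then show "0 \<le> Re (\<Sum>i<n. \<Sum>j<n. cnj (v i) * M $$ (i, j) * v j)"
    using psd[of "vec n v"] by (simp add: less_eq_complex_def)
qed

text \<open>The operators sum to the identity, and compressing the identity to an orthonormal family
  gives the Gram matrix of the family.\<close>

lemma povm_compress_sum:
  assumes "povm n M" and u: "orthonormal_on {..<n} r u" and kl: "k < r" "l < r"
  shows "(\<Sum>a\<in>UNIV. \<Sum>i<n. \<Sum>j<n. cnj (u k i) * M a $$ (i, j) * u l j) = (if k = l then 1 else 0)"
proof -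
  have one: "(\<Sum>a\<in>UNIV. M a $$ (i, j)) = (if i = j then 1 else 0)" if "i < n" "j < n" for i j
  proof -
    have "mat n n (\<lambda>ij. \<Sum>a\<in>UNIV. M a $$ ij) $$ (i, j) = 1\<^sub>m n $$ (i, j)"
      using assms(1) by (simp add: povm_def)
    then show ?thesis using that by simp
  qed
  have "(\<Sum>a\<in>UNIV. \<Sum>i<n. \<Sum>j<n. cnj (u k i) * M a $$ (i, j) * u l j)
      = (\<Sum>i<n. \<Sum>a\<in>UNIV. \<Sum>j<n. cnj (u k i) * M a $$ (i, j) * u l j)"
    by (rule sum.swap)
  also have "\<dots> = (\<Sum>i<n. \<Sum>j<n. \<Sum>a\<in>UNIV. cnj (u k i) * M a $$ (i, j) * u l j)"
    by (rule sum.cong[OF refl], rule sum.swap)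
  also have "\<dots> = (\<Sum>i<n. \<Sum>j<n. cnj (u k i) * (\<Sum>a\<in>UNIV. M a $$ (i, j)) * u l j)"
    by (simp only: sum_distrib_left sum_distrib_right)
  also have "\<dots> = (\<Sum>i<n. \<Sum>j<n. if i = j then cnj (u k i) * u l j else 0)"
    by (intro sum.cong refl) (simp add: one)
  also have "\<dots> = (\<Sum>i<n. cnj (u k i) * u l i)"
    by simp
  finally show ?thesis
    by (simp add: orthonormal_on_swap[OF u kl])
qed

text \<open>Substitute the expansion for both copies of the state, with index \<open>k\<close> for
  the conjugated copy and \<open>l\<close> for the other. Each term then factors into one compressed
  entry of \<open>A\<close> and one of \<open>B\<close>.\<close>

lemma schmidt_bilinear_form:
  fixes u v :: "nat \<Rightarrow> nat \<Rightarrow> complex" and d :: "nat \<Rightarrow> real"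
  assumes K: "\<And>i j. i < n \<Longrightarrow> j < m \<Longrightarrow> K i j = (\<Sum>k<r. d k * u k i * v k j)"
  shows "(\<Sum>i<n. \<Sum>j<m. \<Sum>i'<n. \<Sum>j'<m. A i i' * B j j' * K i' j' * cnj (K i j))
    = (\<Sum>k<r. \<Sum>l<r. d k * d l * (\<Sum>i<n. \<Sum>i'<n. cnj (u k i) * A i i' * u l i')
        * (\<Sum>j<m. \<Sum>j'<m. cnj (v k j) * B j j' * v l j'))"
proof -
  define T where "T = (\<lambda>k l i i' j j'. d k * d l * (cnj (u k i) * A i i' * u l i') * (cnj (v k j) * B j j' * v l j'))"
  have "A i i' * B j j' * K i' j' * cnj (K i j) = (\<Sum>k<r. \<Sum>l<r. T k l i i' j j')"
    if "i < n" "i' < n" "j < m" "j' < m" for i i' j j'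
  proof -
    have "K i' j' * cnj (K i j) = (\<Sum>k<r. \<Sum>l<r. cnj (d k * u k i * v k j) * (d l * u l i' * v l j'))"
      unfolding mult.commute[of "K i' j'"] using that by (simp only: K cnj_sum sum_product)
    then have "A i i' * B j j' * K i' j' * cnj (K i j)
        = A i i' * B j j' * (\<Sum>k<r. \<Sum>l<r. cnj (d k * u k i * v k j) * (d l * u l i' * v l j'))"
      by (simp only: mult.assoc)
    then show ?thesis
      by (simp only: sum_distrib_left, intro sum.cong refl) (simp add: T_def mult_ac)
  qed
  then have "(\<Sum>i<n. \<Sum>j<m. \<Sum>i'<n. \<Sum>j'<m. A i i' * B j j' * K i' j' * cnj (K i j))
      = (\<Sum>i<n. \<Sum>j<m. \<Sum>i'<n. \<Sum>j'<m. \<Sum>k<r. \<Sum>l<r. T k l i i' j j')"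
    by (intro sum.cong refl) simp
  also have "\<dots> = (\<Sum>i<n. \<Sum>j<m. \<Sum>k<r. \<Sum>l<r. \<Sum>i'<n. \<Sum>j'<m. T k l i i' j j')"
    by (rule sum.cong[OF refl], rule sum.cong[OF refl], rule sum_swap_pairs)
  also have "\<dots> = (\<Sum>k<r. \<Sum>l<r. \<Sum>i<n. \<Sum>j<m. \<Sum>i'<n. \<Sum>j'<m. T k l i i' j j')"
    by (rule sum_swap_pairs)
  also have "\<dots> = (\<Sum>k<r. \<Sum>l<r. d k * d l * (\<Sum>i<n. \<Sum>i'<n. cnj (u k i) * A i i' * u l i')
        * (\<Sum>j<m. \<Sum>j'<m. cnj (v k j) * B j j' * v l j'))"
  proof -
    have prod: "(\<Sum>i<n. \<Sum>i'<n. f i i') * (\<Sum>j<m. \<Sum>j'<m. g j j') = (\<Sum>i<n. \<Sum>j<m. \<Sum>i'<n. \<Sum>j'<m. f i i' * g j j')"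
      for f g :: "nat \<Rightarrow> nat \<Rightarrow> complex"
      by (simp only: sum_product)
    show ?thesis
      by (simp only: T_def mult.assoc[of "complex_of_real _"] prod) (simp only: sum_distrib_left)
  qed
  finally show ?thesis .
qed

text \<open>\<open>schmidt_bilinear_form\<close> with the identity kernel \<open>\<delta>\<close> on
  both sides; orthonormality leaves only \<open>k = l\<close>.\<close>

lemma schmidt_norm:
  fixes u v :: "nat \<Rightarrow> nat \<Rightarrow> complex" and d :: "nat \<Rightarrow> real"
  assumes K: "\<And>i j. i < n \<Longrightarrow> j < m \<Longrightarrow> K i j = (\<Sum>k<r. d k * u k i * v k j)"
    and u: "orthonormal_on {..<n} r u" and v: "orthonormal_on {..<m} r v"
  shows "(\<Sum>i<n. \<Sum>j<m. K i j * cnj (K i j)) = complex_of_real (\<Sum>k<r. (d k)\<^sup>2)"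
proof -
  define \<delta> where "\<delta> = (\<lambda>i j :: nat. if i = j then 1 else 0 :: complex)"
  have \<delta>: "(\<Sum>j<n. \<delta> i j * f j) = f i" if "i < n" for i n and f :: "nat \<Rightarrow> complex"
    using that by (simp add: \<delta>_def if_distrib[of "\<lambda>z. z * _"] cong: if_cong)
  have \<delta>_form: "(\<Sum>i<n. \<Sum>i'<n. f i * \<delta> i i' * g i') = (\<Sum>i<n. f i * g i)" for n and f g :: "nat \<Rightarrow> complex"
  proof (rule sum.cong[OF refl])
    fix i assume "i \<in> {..<n}"
    have "(\<Sum>i'<n. f i * \<delta> i i' * g i') = f i * (\<Sum>i'<n. \<delta> i i' * g i')"
      by (simp only: sum_distrib_left mult.assoc)
    then show "(\<Sum>i'<n. f i * \<delta> i i' * g i') = f i * g i"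
      using \<open>i \<in> {..<n}\<close> by (simp add: \<delta>)
  qed
  have "(\<Sum>i<n. \<Sum>j<m. K i j * cnj (K i j))
      = (\<Sum>i<n. \<Sum>j<m. \<Sum>i'<n. \<delta> i i' * (\<Sum>j'<m. \<delta> j j' * (K i' j' * cnj (K i j))))"
    by (intro sum.cong refl) (simp add: \<delta>)
  also have "\<dots> = (\<Sum>i<n. \<Sum>j<m. \<Sum>i'<n. \<Sum>j'<m. \<delta> i i' * \<delta> j j' * K i' j' * cnj (K i j))"
    by (simp only: sum_distrib_left mult.assoc)
  also have "\<dots> = (\<Sum>k<r. \<Sum>l<r. d k * d l * (\<Sum>i<n. \<Sum>i'<n. cnj (u k i) * \<delta> i i' * u l i')
        * (\<Sum>j<m. \<Sum>j'<m. cnj (v k j) * \<delta> j j' * v l j'))"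
    by (rule schmidt_bilinear_form[OF K])
  also have "\<dots> = (\<Sum>k<r. \<Sum>l<r. if k = l then complex_of_real ((d k)\<^sup>2) else 0)"
  proof (intro sum.cong refl)
    fix k l assume "k \<in> {..<r}" "l \<in> {..<r}"
    then have kl: "k < r" "l < r" by auto
    have "(\<Sum>i<n. \<Sum>i'<n. cnj (u k i) * \<delta> i i' * u l i') = (if k = l then 1 else 0)"
      "(\<Sum>j<m. \<Sum>j'<m. cnj (v k j) * \<delta> j j' * v l j') = (if k = l then 1 else 0)"
      unfolding \<delta>_form by (rule orthonormal_on_swap[OF u kl], rule orthonormal_on_swap[OF v kl])
    then show "d k * d l * (\<Sum>i<n. \<Sum>i'<n. cnj (u k i) * \<delta> i i' * u l i')
        * (\<Sum>j<m. \<Sum>j'<m. cnj (v k j) * \<delta> j j' * v l j') = (if k = l then complex_of_real ((d k)\<^sup>2) else 0)"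
      by (simp add: power2_eq_square)
  qed
  also have "\<dots> = complex_of_real (\<Sum>k<r. (d k)\<^sup>2)"
    by simp
  finally show ?thesis .
qed

text \<open>The form in which a strategy enters the Gram matrix: with \<open>D = diag(d)\<close>,
  the correlation is the trace of \<open>D W D W'\<close>, where \<open>W\<close> and
  \<open>W'\<close> are the compressed operators of the two answers.\<close>

lemma quantum_correlation_kernels:
  fixes p :: "('a::finite, 'b::finite, 's::finite, 't::finite) correlation"
  assumes "p \<in> quantum_correlations"
  obtains r and d :: "nat \<Rightarrow> real" and W :: "('a, 'b, 's, 't) index \<Rightarrow> nat \<Rightarrow> nat \<Rightarrow> complex"
  where "\<And>k. k < r \<Longrightarrow> 0 \<le> d k" "(\<Sum>k<r. (d k)\<^sup>2) = 1" "\<And>x. psd_kernel {..<r} (W x)"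
    "\<And>q k l. k < r \<Longrightarrow> l < r \<Longrightarrow> (\<Sum>x\<in>block q. W x k l) = (if k = l then 1 else 0)"
    "\<And>a b s t. complex_of_real (p a b s t)
       = (\<Sum>k<r. \<Sum>l<r. d k * d l * W (Inl (s, a)) k l * W (Inr (t, b)) l k)"
proof -
  from assms obtain n m \<psi> and X :: "'s \<Rightarrow> 'a \<Rightarrow> complex mat" and Y :: "'t \<Rightarrow> 'b \<Rightarrow> complex mat"
    where \<psi>: "\<psi> \<in> carrier_vec (n * m)" "\<psi> \<bullet>c \<psi> = 1"
      and X: "\<And>s. povm n (X s)" and Y: "\<And>t. povm m (Y t)"
      and p: "\<And>a b s t. complex_of_real (p a b s t) = (kronecker (X s a) (Y t b) *\<^sub>v \<psi>) \<bullet>c \<psi>"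
    unfolding quantum_correlations_def by blast
  define K where "K = (\<lambda>i j. vec_index \<psi> (i * m + j))"
  obtain r and u v :: "nat \<Rightarrow> nat \<Rightarrow> complex" and d :: "nat \<Rightarrow> real" where u: "orthonormal_on {..<n} r u" and v: "orthonormal_on {..<m} r v"
    and d: "\<And>k. k < r \<Longrightarrow> 0 \<le> d k"
    and K: "\<And>i j. i \<in> {..<n} \<Longrightarrow> j \<in> {..<m} \<Longrightarrow> K i j = (\<Sum>k<r. d k * u k i * v k j)"
    by (rule schmidt_decomposition[of "{..<n}" "{..<m}" K]) auto
  have K': "\<And>i j. i < n \<Longrightarrow> j < m \<Longrightarrow> K i j = (\<Sum>k<r. d k * u k i * v k j)"
    using K by simp
  have psd: "hermitian_psd n (X s a)" "hermitian_psd m (Y t b)" for s a t b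
    using X Y by (auto simp: povm_def)
  have carrier: "X s a \<in> carrier_mat n n" "Y t b \<in> carrier_mat m m" for s a t b
    using psd by (auto simp: hermitian_psd_def)
  \<comment> \<open>The kernels of the second player are transposed, so that the correlation becomes a trace of a
    product and the two players are treated alike.\<close>
  define W :: "('a, 'b, 's, 't) index \<Rightarrow> nat \<Rightarrow> nat \<Rightarrow> complex" where
    "W = (\<lambda>x k l. case x of
        Inl (s, a) \<Rightarrow> \<Sum>i<n. \<Sum>j<n. cnj (u k i) * X s a $$ (i, j) * u l j
      | Inr (t, b) \<Rightarrow> \<Sum>i<m. \<Sum>j<m. cnj (v l i) * Y t b $$ (i, j) * v k j)"
  show thesis
  proof (rule that[of r d W])
    have "complex_of_real (\<Sum>k<r. (d k)\<^sup>2) = (\<Sum>i<n. \<Sum>j<m. K i j * cnj (K i j))"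
      by (rule schmidt_norm[OF K' u v, symmetric])
    also have "\<dots> = \<psi> \<bullet>c \<psi>"
      using \<psi>(1) by (simp add: scalar_prod_def atLeast0LessThan sum_nat_pairs K_def)
    finally show "(\<Sum>k<r. (d k)\<^sup>2) = 1"
      using \<psi>(2) of_real_eq_1_iff by metis
    show "psd_kernel {..<r} (W x)" for x
    proof (cases x)
      case (Inl y)
      obtain s a where "y = (s, a)" by (cases y)
      then show ?thesis
        using psd_kernel_compress[OF hermitian_psd_kernel[OF psd(1)]] by (simp add: Inl W_def)
    next
      case (Inr y)
      obtain t b where "y = (t, b)" by (cases y)
      then show ?thesis
        using psd_kernel_transpose[OF psd_kernel_compress[OF hermitian_psd_kernel[OF psd(2)]]] by (simp add: Inr W_def)
    qed
    \<comment> \<open>\<open>that(2,1)\<close> exchanges \<open>k\<close> and \<open>l\<close>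
      because the kernels of the second player are transposed.\<close>
    show "(\<Sum>x\<in>block q. W x k l) = (if k = l then 1 else 0)" if "k < r" "l < r" for q k l
      using povm_compress_sum[OF X u that] povm_compress_sum[OF Y v that(2,1)]
      by (cases q) (auto simp: W_def sum_block_Inl sum_block_Inr simp del: block.simps)
    show "complex_of_real (p a b s t)
        = (\<Sum>k<r. \<Sum>l<r. d k * d l * W (Inl (s, a)) k l * W (Inr (t, b)) l k)" for a b s t
    proof -
      have "complex_of_real (p a b s t) = (\<Sum>i<n. \<Sum>j<m. \<Sum>i'<n. \<Sum>j'<m.
          X s a $$ (i, i') * Y t b $$ (j, j') * K i' j' * cnj (K i j))"
        unfolding p K_def by (rule kronecker_form[OF carrier \<psi>(1)])
      also have "\<dots> = (\<Sum>k<r. \<Sum>l<r. d k * d l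
          * (\<Sum>i<n. \<Sum>i'<n. cnj (u k i) * X s a $$ (i, i') * u l i')
          * (\<Sum>j<m. \<Sum>j'<m. cnj (v k j) * Y t b $$ (j, j') * v l j'))"
        by (rule schmidt_bilinear_form[OF K'])
      finally show ?thesis by (simp add: W_def)
    qed
  qed (use d in auto)
qed

text \<open>At \<open>v\<close> the form equals the sum of
  \<open>d k * d l * (cmod (Z k l))^2\<close>, where \<open>Z\<close>, the combination of the
  \<open>W x\<close> with coefficients \<open>v\<close>, is Hermitian. The entries are nonnegative
  by \<open>psd_kernel_trace_nonneg\<close>.\<close>

lemma psd_kernel_gram:
  fixes d :: "nat \<Rightarrow> real" and W :: "'x::finite \<Rightarrow> nat \<Rightarrow> nat \<Rightarrow> complex"
  assumes d: "\<And>k. k < r \<Longrightarrow> 0 \<le> d k" and W: "\<And>x. psd_kernel {..<r} (W x)"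
  shows "(\<chi> x y. Re (\<Sum>k<r. \<Sum>l<r. d k * d l * W x k l * W y l k)) \<in> dnn_matrices" (is "?R \<in> _")
proof -
  have "Re (\<Sum>k<r. \<Sum>l<r. d k * d l * W x k l * W y l k) = Re (\<Sum>k<r. \<Sum>l<r. d k * d l * W y k l * W x l k)" for x y
    by (subst sum.swap) (simp add: mult_ac)
  then have "transpose ?R = ?R"
    by (simp add: transpose_def vec_eq_iff)
  moreover have "0 \<le> inner v (?R *v v)" for v
  proof -
    define Z where "Z = (\<lambda>k l. \<Sum>x\<in>UNIV. v $ x * W x k l)"
    have Z: "Z l k = cnj (Z k l)" if "k < r" "l < r" for k l
    proof -
      have "W x l k = cnj (W x k l)" for x
        using that by (intro psd_kernelD(1)[OF W]) auto
      then show ?thesis by (simp add: Z_def)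
    qed
    have ReM: "Re z * a * b = Re (z * a * b)" for z and a b :: real
      by simp
    have "inner v (?R *v v)
        = (\<Sum>x\<in>UNIV. \<Sum>y\<in>UNIV. Re (\<Sum>k<r. \<Sum>l<r. d k * d l * W x k l * W y l k) * v $ x * v $ y)"
      by (simp only: quadratic_form_expand vec_lambda_beta)
    also have "\<dots> = Re (\<Sum>x\<in>UNIV. \<Sum>y\<in>UNIV. (\<Sum>k<r. \<Sum>l<r. d k * d l * W x k l * W y l k) * v $ x * v $ y)"
      by (simp only: ReM flip: Re_sum)
    also have "\<dots> = Re (\<Sum>x\<in>UNIV. \<Sum>y\<in>UNIV. \<Sum>k<r. \<Sum>l<r. d k * d l * W x k l * W y l k * v $ x * v $ y)"
      by (simp only: sum_distrib_right)
    also have "(\<Sum>x\<in>UNIV. \<Sum>y\<in>UNIV. \<Sum>k<r. \<Sum>l<r. d k * d l * W x k l * W y l k * v $ x * v $ y)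
        = (\<Sum>k<r. \<Sum>l<r. \<Sum>x\<in>UNIV. \<Sum>y\<in>UNIV. d k * d l * W x k l * W y l k * v $ x * v $ y)"
      by (rule sum_swap_pairs)
    also have "\<dots> = (\<Sum>k<r. \<Sum>l<r. d k * d l * (Z k l * Z l k))"
      by (intro sum.cong refl, simp only: Z_def sum_product, simp only: sum_distrib_left) (simp only: mult_ac)
    also have "\<dots> = (\<Sum>k<r. \<Sum>l<r. complex_of_real (d k * d l * (cmod (Z k l))\<^sup>2))"
    proof (intro sum.cong refl)
      fix k l assume "k \<in> {..<r}" "l \<in> {..<r}"
      then have "Z k l * Z l k = complex_of_real ((cmod (Z k l))\<^sup>2)"
        unfolding complex_norm_square using Z[of k l] by simp
      then show "d k * d l * (Z k l * Z l k) = complex_of_real (d k * d l * (cmod (Z k l))\<^sup>2)"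
        by simp
    qed
    also have "Re \<dots> = (\<Sum>k<r. \<Sum>l<r. d k * d l * (cmod (Z k l))\<^sup>2)"
      by (simp only: Re_sum Re_complex_of_real)
    also have "\<dots> \<ge> 0"
      using d by (intro sum_nonneg mult_nonneg_nonneg) auto
    finally show ?thesis .
  qed
  moreover have "0 \<le> ?R $ x $ y" for x y
    using psd_kernel_trace_nonneg[OF _ W W] by simp
  ultimately show ?thesis
    unfolding dnn_matrices_def psd_matrices_def by blast
qed

lemma quantum_correlation_dnn:
  fixes p :: "('a::finite, 'b::finite, 's::finite, 't::finite) correlation"
  assumes "p \<in> quantum_correlations"
  obtains X :: "real ^ ('a, 'b, 's, 't) index ^ ('a, 'b, 's, 't) index"
  where "X \<in> dnn_matrices" "\<And>i j. block_sum i j X = 1" "\<And>a b s t. X $ Inl (s, a) $ Inr (t, b) = p a b s t"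
proof -
  obtain r and d :: "nat \<Rightarrow> real" and W :: "('a, 'b, 's, 't) index \<Rightarrow> nat \<Rightarrow> nat \<Rightarrow> complex"
    where d: "\<And>k. k < r \<Longrightarrow> 0 \<le> d k" "(\<Sum>k<r. (d k)\<^sup>2) = 1" and W: "\<And>x. psd_kernel {..<r} (W x)"
      and blocks: "\<And>q k l. k < r \<Longrightarrow> l < r \<Longrightarrow> (\<Sum>x\<in>block q. W x k l) = (if k = l then 1 else 0)"
      and p: "\<And>a b s t. complex_of_real (p a b s t)
        = (\<Sum>k<r. \<Sum>l<r. d k * d l * W (Inl (s, a)) k l * W (Inr (t, b)) l k)"
    by (rule quantum_correlation_kernels[OF assms]) (rule that; assumption)
  define X where "X = (\<chi> x y. Re (\<Sum>k<r. \<Sum>l<r. d k * d l * W x k l * W y l k))"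
  show thesis
  proof (rule that[of X])
    show "X \<in> dnn_matrices"
      unfolding X_def by (rule psd_kernel_gram[OF d(1) W])
    show "X $ Inl (s, a) $ Inr (t, b) = p a b s t" for a b s t
      by (simp only: X_def vec_lambda_beta p[symmetric] Re_complex_of_real)
    show "block_sum i j X = 1" for i j
    proof -
      \<comment> \<open>Summing over the two blocks replaces both kernels by the identity, so what
        remains is the squared norm of the Schmidt coefficients.\<close>
      have "(\<Sum>x\<in>block i. \<Sum>y\<in>block j. \<Sum>k<r. \<Sum>l<r. d k * d l * (W x k l * W y l k))
          = (\<Sum>k<r. \<Sum>l<r. \<Sum>x\<in>block i. \<Sum>y\<in>block j. d k * d l * (W x k l * W y l k))"
        by (rule sum_swap_pairs)
      also have "\<dots> = (\<Sum>k<r. \<Sum>l<r. d k * d l * ((\<Sum>x\<in>block i. W x k l) * (\<Sum>y\<in>block j. W y l k)))"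
        by (simp only: sum_product) (simp only: sum_distrib_left)
      also have "\<dots> = (\<Sum>k<r. \<Sum>l<r. if k = l then complex_of_real ((d k)\<^sup>2) else 0)"
        by (intro sum.cong refl) (auto simp: blocks power2_eq_square)
      also have "\<dots> = complex_of_real (\<Sum>k<r. (d k)\<^sup>2)"
        by simp
      finally have "(\<Sum>x\<in>block i. \<Sum>y\<in>block j. \<Sum>k<r. \<Sum>l<r. d k * d l * (W x k l * W y l k)) = 1"
        by (simp only: d(2) of_real_1)
      moreover have "block_sum i j X
          = Re (\<Sum>x\<in>block i. \<Sum>y\<in>block j. \<Sum>k<r. \<Sum>l<r. d k * d l * (W x k l * W y l k))"
        by (simp only: block_sum_def X_def vec_lambda_beta Re_sum mult.assoc)
      ultimately show ?thesis by simp
    qed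
  qed
qed

subsection \<open>Comparison of the three values\<close>

text \<open>On one-dimensional spaces the players always answer \<open>a0\<close> and
  \<open>b0\<close>. Nonemptiness is what makes the suprema of the values comparable on the
  reals.\<close>

lemma quantum_correlations_nonempty:
  "(quantum_correlations :: ('a::finite, 'b::finite, 's, 't) correlation set) \<noteq> {}"
proof -
  define a0 :: 'a and b0 :: 'b where "a0 = undefined" and "b0 = undefined"
  define e where "e = (\<lambda>c. mat 1 1 (\<lambda>_. of_bool c) :: complex mat)"
  define \<psi> :: "complex vec" where "\<psi> = vec 1 (\<lambda>_. 1)"
  have "mat_adjoint (e c) = e c" for c
    by (rule eq_matI) (auto simp: mat_adjoint_def mat_of_rows_def e_def)
  then have psd: "hermitian_psd 1 (e c)" for c
    by (auto simp: hermitian_psd_def e_def scalar_prod_def less_eq_complex_def)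
  have povm: "povm 1 (\<lambda>a. e (a = a0))" "povm 1 (\<lambda>b. e (b = b0))"
    using psd by (auto simp: povm_def e_def intro!: eq_matI)
  have "(kronecker (e c) (e c') *\<^sub>v \<psi>) \<bullet>c \<psi> = of_bool (c \<and> c')" for c c'
    by (simp add: kronecker_def e_def \<psi>_def scalar_prod_def)
  then have kron: "complex_of_real (of_bool (a = a0 \<and> b = b0)) = (kronecker (e (a = a0)) (e (b = b0)) *\<^sub>v \<psi>) \<bullet>c \<psi>"
    for a b by simp
  have \<psi>: "\<psi> \<in> carrier_vec (1 * 1)" "\<psi> \<bullet>c \<psi> = 1"
    by (simp_all add: \<psi>_def scalar_prod_def)
  define p :: "('a, 'b, 's, 't) correlation" where "p = (\<lambda>a b s t. of_bool (a = a0 \<and> b = b0))"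
  have "(\<Sum>a\<in>UNIV. \<Sum>b\<in>UNIV. of_bool (a = a0 \<and> b = b0) :: real) = (\<Sum>a\<in>UNIV. of_bool (a = a0))"
    by (rule sum.cong[OF refl]) (simp add: of_bool_def)
  also have "\<dots> = 1"
    by (simp add: of_bool_def)
  finally have "p \<in> correlations"
    by (simp only: correlations_def p_def) simp
  moreover have "complex_of_real (p a b s t) = (kronecker (e (a = a0)) (e (b = b0)) *\<^sub>v \<psi>) \<bullet>c \<psi>" for a b s t
    unfolding p_def by (rule kron)
  ultimately have "p \<in> quantum_correlations"
    unfolding quantum_correlations_def mem_Collect_eq using \<psi> povm
    by (intro conjI exI[of _ 1] exI[of _ \<psi>] exI[of _ "\<lambda>_ a. e (a = a0)"] exI[of _ "\<lambda>_ b. e (b = b0)"]) simp_all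
  then show ?thesis by blast
qed

text \<open>An average over \<open>\<pi>\<close> of probabilities; it supplies the upper bound for
  the suprema.\<close>

lemma win_le_1:
  fixes p :: "('a::finite, 'b::finite, 's::finite, 't::finite) correlation"
  assumes "p \<in> correlations"
  shows "win \<pi> V p \<le> 1"
proof -
  have "(\<Sum>a\<in>UNIV. \<Sum>b\<in>UNIV. of_bool (V a b s t) * p a b s t) \<le> 1" for s t
  proof -
    have "(\<Sum>a\<in>UNIV. \<Sum>b\<in>UNIV. of_bool (V a b s t) * p a b s t) \<le> (\<Sum>a\<in>UNIV. \<Sum>b\<in>UNIV. p a b s t)"
      using assms by (intro sum_mono) (auto simp: correlations_def)
    then show ?thesis using assms by (simp add: correlations_def)
  qed
  then have "win \<pi> V p \<le> (\<Sum>s\<in>UNIV. \<Sum>t\<in>UNIV. pmf \<pi> (s, t) * 1)"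
    unfolding win_def by (intro sum_mono mult_left_mono) auto
  also have "\<dots> = (\<Sum>z\<in>UNIV. pmf \<pi> z)"
    by (simp add: sum_UNIV_prod)
  also have "\<dots> = 1"
    by (rule sum_pmf_eq_1) auto
  finally show ?thesis .
qed

theorem mainTheorem3:
  fixes \<pi> :: "('s::finite \<times> 't::finite) pmf"
    and V :: "('a::finite, 'b::finite, 's, 't) predicate"
  shows "quantum_value \<pi> V \<le> dnn_value \<pi> V \<and> dnn_value \<pi> V \<le> sdp1_value \<pi> V"
proof -
  define Q where "Q = win \<pi> V ` quantum_correlations"
  define D where "D = {trace (symm_cost_matrix \<pi> V ** X) | X. (\<forall>i j. block_sum i j X = 1) \<and> X \<in> dnn_matrices}"
  define N where "N = win \<pi> V ` npa1"
  have trace: "trace (symm_cost_matrix \<pi> V ** X) = win \<pi> V (\<lambda>a b s t. X $ Inl (s, a) $ Inr (t, b))"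
    if "X \<in> dnn_matrices" for X
    using that by (intro trace_symm_cost_matrix) (simp add: dnn_matrices_def psd_matrices_def)
  have "Q \<noteq> {}"
    by (simp add: Q_def quantum_correlations_nonempty)
  have "Q \<subseteq> D"
  proof
    fix w assume "w \<in> Q"
    then obtain p where p: "p \<in> quantum_correlations" "w = win \<pi> V p"
      by (auto simp: Q_def)
    obtain X where X: "X \<in> dnn_matrices" "\<And>i j. block_sum i j X = 1"
      "\<And>a b s t. X $ Inl (s, a) $ Inr (t, b) = p a b s t"
      by (rule quantum_correlation_dnn[OF p(1)]) (rule that; assumption)
    have "w = trace (symm_cost_matrix \<pi> V ** X)"
      unfolding trace[OF X(1)] X(3) by (rule p(2))
    then show "w \<in> D"
      using X(1,2) unfolding D_def by blast
  qed
  have "D \<subseteq> N"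
  proof
    fix w assume "w \<in> D"
    then obtain X where X: "X \<in> dnn_matrices" "\<And>i j. block_sum i j X = 1"
      and w: "w = trace (symm_cost_matrix \<pi> V ** X)"
      by (auto simp: D_def)
    show "w \<in> N"
      unfolding w trace[OF X(1)] N_def by (intro imageI dnn_feasible_npa1 X)
  qed
  \<comment> \<open>\<open>N\<close> is the largest of the three sets of values, so its bound also
    serves \<open>D\<close> and \<open>Q\<close>.\<close>
  have "bdd_above N"
    unfolding N_def bdd_above_def
    by (rule exI[of _ 1]) (auto simp: npa1_def no_signalling_def intro!: win_le_1)
  have "quantum_value \<pi> V \<le> dnn_value \<pi> V"
    unfolding quantum_value_def dnn_value_def Q_def[symmetric] D_def[symmetric]
    using \<open>Q \<noteq> {}\<close> \<open>Q \<subseteq> D\<close> \<open>D \<subseteq> N\<close> \<open>bdd_above N\<close> by (intro cSup_subset_mono) (auto intro: bdd_above_mono)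
  moreover have "dnn_value \<pi> V \<le> sdp1_value \<pi> V"
    unfolding sdp1_value_def dnn_value_def N_def[symmetric] D_def[symmetric]
    using \<open>Q \<noteq> {}\<close> \<open>Q \<subseteq> D\<close> \<open>D \<subseteq> N\<close> \<open>bdd_above N\<close> by (intro cSup_subset_mono) auto
  ultimately show ?thesis by blast
qed

end
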